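(* Let $L\ge1$, $d\ge 1$, $n\ge 1$ be integers and $V,B,\sigma>0$. Let $\mathcal{F}_{L,V,B}$ be the collection of all functions in $\mathcal{F}_{L,V}$ (the $L$-layer ReLU networks on $[-1,1]^d$ of total path variation at most $V$) that are bounded in absolute value by $B$ on $[-1,1]^d$. Let $X_1,\dots,X_n$ be i.i.d. with an arbitrary distribution $P_X$ on $[-1,1]^d$, let $\varepsilon_1,\dots,\varepsilon_n$ be i.i.d. Normal$(0,\sigma^2)$ independent of the $X_i$, and let $Y_i=f^*(X_i)+\varepsilon_i$ where $f^*\in\mathcal{F}_{L,V,B}$. Let $\hat f$ be the constrained least squares estimator, that is, a minimizer of $\frac1n\sum_{i=1}^n(Y_i-f(X_i))^2$ over $f\in\mathcal{F}_{L,V,B}$. Then $$E\big[\|\hat f-f^*\|^2\big]\le 2V(\sigma+4B)\sqrt{\frac{2\,(L\log 2+\log(2d))}{n}},$$ where $\|g\|^2=\int g(x)^2\,P_X(dx)$.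
   Context: Definition of $\mathcal{F}_{L,V}$: fix a Lipschitz-$1$ function $\phi_{out}:\mathbb{R}\to\mathbb{R}$ (possibly the identity). $\mathcal{F}_{L,V}$ is the set of functions $f:[-1,1]^d\to\mathbb{R}$ of the form $$f(x)=\phi_{out}\Big(\sum_{j_1} w_{j_1}\Big(\sum_{j_2} w_{j_1,j_2}\cdots\Big(\sum_{j_L=1}^{d} w_{j_{L-1},j_L}x_{j_L}\Big)_+\cdots\Big)_+\Big),$$ with real weights, arbitrary finite numbers of units $d_1,\dots,d_{L-1}$ on the layers $1,\dots,L-1$ (so $1\le j_\ell\le d_\ell$), $(z)_+=\max\{z,0\}$, and total path variation $\sum_{j_1,\dots,j_L}|w_{j_1}||w_{j_1,j_2}|\cdots|w_{j_{L-1},j_L}|\le V$ (for $L=1$, $f(x)=\phi_{out}(\sum_{j_1}w_{j_1}x_{j_1})$ with $\sum|w_{j_1}|\le V$). Offsets are included by allowing one input coordinate to be locked at $1$. Logarithms are natural. The estimator $\hat f$ is assumed to exist and be measurable, and the expectation is over the training data. *)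

theory Defs
  imports "HOL-Probability.Probability"
begin

definition unit_cube :: "(real ^ 'd) set" where
  "unit_cube = {x. \<forall>k. x $ k \<in> {-1..1}}"

abbreviation cube_borel :: "(real ^ 'd) measure" where
  "cube_borel \<equiv> restrict_space borel unit_cube"

(* Layers are numbered from the input upwards, so a network with L weight layers has its single
   output node on level H = L - 1.  Level h has the D h units {..<D h}; a i k is the weight from
   the input coordinate k to unit i of level 0, and w h i j is the weight from unit j of level h
   to unit i of level Suc h. preactivation D w a h i x is the argument of the positive part at
   unit i of level h, except on the output level, where no positive part is taken. *)

primrec preactivation ::
  "(nat \<Rightarrow> nat) \<Rightarrow> (nat \<Rightarrow> nat \<Rightarrow> nat \<Rightarrow> real) \<Rightarrow> (nat \<Rightarrow> 'd::finite \<Rightarrow> real) \<Rightarrow>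
    nat \<Rightarrow> nat \<Rightarrow> real ^ 'd \<Rightarrow> real" where
  "preactivation D w a 0 i x = (\<Sum>k\<in>UNIV. a i k * x $ k)"
| "preactivation D w a (Suc h) i x = (\<Sum>j<D h. w h i j * max (preactivation D w a h j x) 0)"

(* A path consists of an input coordinate k and a unit p h on every level h \<le> H. *)

definition path_variation ::
  "(nat \<Rightarrow> nat) \<Rightarrow> (nat \<Rightarrow> nat \<Rightarrow> nat \<Rightarrow> real) \<Rightarrow> (nat \<Rightarrow> 'd::finite \<Rightarrow> real) \<Rightarrow> nat \<Rightarrow> real" where
  "path_variation D w a H =
    (\<Sum>p\<in>(\<Pi>\<^sub>E h\<in>{..H}. {..<D h}). \<Sum>k\<in>UNIV.
      (\<Prod>h<H. \<bar>w h (p (Suc h)) (p h)\<bar>) * \<bar>a (p 0) k\<bar>)"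

(* Functions on the cube are represented by total functions whose values off the cube are
   irrelevant. *)

definition relu_class :: "(real \<Rightarrow> real) \<Rightarrow> nat \<Rightarrow> real \<Rightarrow> (real ^ 'd::finite \<Rightarrow> real) set" where
  "relu_class \<phi> L V =
    {f. \<exists>D w a. D (L - 1) = 1 \<and> path_variation D w a (L - 1) \<le> V \<and>
          (\<forall>x\<in>unit_cube. f x = \<phi> (preactivation D w a (L - 1) 0 x))}"

definition bounded_relu_class ::
  "(real \<Rightarrow> real) \<Rightarrow> nat \<Rightarrow> real \<Rightarrow> real \<Rightarrow> (real ^ 'd::finite \<Rightarrow> real) set" where
  "bounded_relu_class \<phi> L V B = {f \<in> relu_class \<phi> L V. \<forall>x\<in>unit_cube. \<bar>f x\<bar> \<le> B}"

definition empirical_risk :: "nat \<Rightarrow> (nat \<Rightarrow> 'x \<times> real) \<Rightarrow> ('x \<Rightarrow> real) \<Rightarrow> real" where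
  "empirical_risk n z f = (1 / real n) * (\<Sum>i<n. (snd (z i) - f (fst (z i)))\<^sup>2)"

definition sq_L2_norm :: "'x measure \<Rightarrow> ('x \<Rightarrow> real) \<Rightarrow> real" where
  "sq_L2_norm P g = (\<integral>x. (g x)\<^sup>2 \<partial>P)"

definition training_data ::
  "nat \<Rightarrow> (nat \<Rightarrow> 'o \<Rightarrow> 'x) \<Rightarrow> (nat \<Rightarrow> 'o \<Rightarrow> real) \<Rightarrow> 'o \<Rightarrow> nat \<Rightarrow> 'x \<times> real" where
  "training_data n X Y \<omega> = (\<lambda>i\<in>{..<n}. (X i \<omega>, Y i \<omega>))"

(* Independence of two random variables whose value types may differ; the library's indep_var
   requires them to agree. *)

definition indep_rv ::
  "'o measure \<Rightarrow> 'x measure \<Rightarrow> ('o \<Rightarrow> 'x) \<Rightarrow> 'y measure \<Rightarrow> ('o \<Rightarrow> 'y) \<Rightarrow> bool" where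
  "indep_rv M S U T W \<longleftrightarrow> U \<in> measurable M S \<and> W \<in> measurable M T \<and>
    prob_space.indep_set M {U -` A \<inter> space M | A. A \<in> sets S} {W -` A \<inter> space M | A. A \<in> sets T}"

end

theory Submission
  imports Defs
begin

text \<open>
  Comparing the empirical risks of \<open>fhat\<close> and \<open>fstar\<close> bounds the empirical squared error by the noise
  correlation \<open>2/n * (\<Sum>i<n. \<epsilon> i * (f (X i) - fstar (X i)))\<close>, and a ghost sample bounds the difference of the
  population and the empirical squared error. The suprema of both over the class are symmetrised by random
  signs, the first because the Gaussian noise is symmetric, the second by exchanging sample and ghost points.
  For fixed data the average over the signs is controlled by its exponential moment at a temperature
  \<open>\<theta>\<close>: contraction removes \<open>\<phi>\<close>, the square, and each positive part, and since a network of path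
  variation \<open>V\<close> is a signed sub-convex combination of positive parts of networks of variation \<open>V\<close> with one
  layer less, every hidden layer costs only a factor 2, for the sign. The linear layer leaves
  \<open>2 * CARD('d)\<close> sub-Gaussian sums. The bound at \<open>\<theta>\<close> is affine in \<open>\<Sum>i<n. (\<epsilon> i)\<^sup>2\<close>, so the
  Gaussian noise needs no further estimate.
\<close>

section \<open>Averages over signs and contraction\<close>

text \<open>Half the left side is the moment generating function of a random sign, so this is
  Hoeffding's lemma with \<open>p = 1 / 2\<close> and interval length \<open>2 * y\<close>. That
  lemma wants a nonnegative length; evenness in \<open>x\<close> covers the other sign.\<close>

lemma exp_le_cosh_bound: "exp x + exp (- x) \<le> 2 * exp (x\<^sup>2 / 2)" for x :: real
proof -
  have *: "exp y + exp (- y) \<le> 2 * exp (y\<^sup>2 / 2)" if "0 \<le> y" for y :: real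
  proof -
    have eq: "exp (- y) * (1 + (exp (2 * y) - 1) / 2) = (exp y + exp (- y)) / 2"
      by (simp add: field_simps flip: exp_add)
    have "0 < 1 + (exp (2 * y) - 1) / 2"
      by (simp add: field_simps add_pos_pos)
    then have "ln ((exp y + exp (- y)) / 2) = - y + ln (1 + (exp (2 * y) - 1) / 2)"
      unfolding eq[symmetric] by (simp add: ln_mult_pos)
    then have "ln ((exp y + exp (- y)) / 2) \<le> y\<^sup>2 / 2"
      using Hoeffdings_lemma_aux[of "2 * y" "1 / 2"] that by (simp add: power_mult_distrib)
    then have "exp (ln ((exp y + exp (- y)) / 2)) \<le> exp (y\<^sup>2 / 2)"
      by simp
    then show ?thesis
      by (simp add: add_pos_pos)
  qed
  show ?thesis
    using *[of x] *[of "- x"] by (cases "0 \<le> x") (simp_all add: add.commute)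
qed

text \<open>The first two hypotheses say that index 1 is the better choice for the plus sign and
  index 2 for the minus sign. If \<open>q\<^sub>1\<close> and \<open>q\<^sub>2\<close> have opposite
  signs, each exponential grows by itself. If they share a sign, convexity of \<open>exp\<close>
  lets the gain at the entry of larger modulus pay for the loss at the other one; which of the two
  arrangements wins depends on which modulus is larger.\<close>

lemma contraction_step:
  fixes u\<^sub>1 u\<^sub>2 p\<^sub>1 p\<^sub>2 q\<^sub>1 q\<^sub>2 :: real
  assumes "u\<^sub>2 + p\<^sub>2 \<le> u\<^sub>1 + p\<^sub>1" and "u\<^sub>1 - p\<^sub>1 \<le> u\<^sub>2 - p\<^sub>2"
    and "\<bar>p\<^sub>1 - p\<^sub>2\<bar> \<le> \<bar>q\<^sub>1 - q\<^sub>2\<bar>" and "\<bar>p\<^sub>1\<bar> \<le> \<bar>q\<^sub>1\<bar>" and "\<bar>p\<^sub>2\<bar> \<le> \<bar>q\<^sub>2\<bar>"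
  shows "exp (u\<^sub>1 + p\<^sub>1) + exp (u\<^sub>2 - p\<^sub>2) \<le> exp (u\<^sub>1 + q\<^sub>1) + exp (u\<^sub>2 - q\<^sub>2) \<or>
    exp (u\<^sub>1 + p\<^sub>1) + exp (u\<^sub>2 - p\<^sub>2) \<le> exp (u\<^sub>1 - q\<^sub>1) + exp (u\<^sub>2 + q\<^sub>2)"
proof -
  \<comment> \<open>The increment of \<open>exp\<close> over an interval grows with the left end
    point and with the length.\<close>
  have *: "exp (b::real) - exp a \<le> exp b' - exp a'" if "a \<le> a'" "b - a \<le> b' - a'" "a \<le> b" for a a' b b'
  proof -
    have "exp b - exp a = exp a * (exp (b - a) - 1)" by (simp add: algebra_simps flip: exp_add)
    also have "\<dots> \<le> exp a' * (exp (b' - a') - 1)"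
      using that by (intro mult_mono) auto
    also have "\<dots> = exp b' - exp a'" by (simp add: algebra_simps flip: exp_add)
    finally show ?thesis .
  qed
  have same_sign: "exp (u\<^sub>1 + p\<^sub>1) + exp (u\<^sub>2 - p\<^sub>2) \<le> exp (u\<^sub>1 + r\<^sub>1) + exp (u\<^sub>2 - r\<^sub>2) \<or>
    exp (u\<^sub>1 + p\<^sub>1) + exp (u\<^sub>2 - p\<^sub>2) \<le> exp (u\<^sub>1 - r\<^sub>1) + exp (u\<^sub>2 + r\<^sub>2)"
    if r: "\<bar>p\<^sub>1 - p\<^sub>2\<bar> \<le> \<bar>r\<^sub>1 - r\<^sub>2\<bar>" "\<bar>p\<^sub>1\<bar> \<le> r\<^sub>1" "\<bar>p\<^sub>2\<bar> \<le> r\<^sub>2" for r\<^sub>1 r\<^sub>2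
  proof (cases "r\<^sub>2 \<le> r\<^sub>1")
    case True
    then show ?thesis using *[of "u\<^sub>2 - r\<^sub>2" "u\<^sub>1 + p\<^sub>1" "u\<^sub>2 - p\<^sub>2" "u\<^sub>1 + r\<^sub>1"] r assms(1,2) by linarith
  next
    case False
    then show ?thesis using *[of "u\<^sub>1 - r\<^sub>1" "u\<^sub>2 - p\<^sub>2" "u\<^sub>1 + p\<^sub>1" "u\<^sub>2 + r\<^sub>2"] r assms(1,2) by linarith
  qed
  consider "0 \<le> q\<^sub>1" "0 \<le> q\<^sub>2" | "q\<^sub>1 \<le> 0" "q\<^sub>2 \<le> 0" | "0 \<le> q\<^sub>1" "q\<^sub>2 \<le> 0" | "q\<^sub>1 \<le> 0" "0 \<le> q\<^sub>2"
    by linarith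
  then show ?thesis
  proof cases
    case 1
    then show ?thesis using same_sign[of q\<^sub>1 q\<^sub>2] assms by auto
  next
    case 2
    then show ?thesis using same_sign[of "- q\<^sub>1" "- q\<^sub>2"] assms by (auto simp: abs_minus_commute)
  next
    case 3
    then have "exp (u\<^sub>1 + p\<^sub>1) + exp (u\<^sub>2 - p\<^sub>2) \<le> exp (u\<^sub>1 + q\<^sub>1) + exp (u\<^sub>2 - q\<^sub>2)"
      using assms by (intro add_mono) auto
    then show ?thesis ..
  next
    case 4
    then have "exp (u\<^sub>1 + p\<^sub>1) + exp (u\<^sub>2 - p\<^sub>2) \<le> exp (u\<^sub>1 - q\<^sub>1) + exp (u\<^sub>2 + q\<^sub>2)"
      using assms by (intro add_mono) auto
    then show ?thesis ..
  qed
qed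

definition signs :: "nat \<Rightarrow> (nat \<Rightarrow> real) set" where
  "signs n = (\<Pi>\<^sub>E i\<in>{..<n}. {-1, 1})"

lemma finite_signs [simp]: "finite (signs n)"
  unfolding signs_def by (intro finite_PiE) auto

lemma card_signs [simp]: "card (signs n) = 2 ^ n"
  by (simp add: signs_def card_PiE numeral_2_eq_2)

lemma signs_nonempty [simp]: "signs n \<noteq> {}"
  by (simp add: signs_def PiE_eq_empty_iff)

lemma signsD: "s \<in> signs n \<Longrightarrow> i < n \<Longrightarrow> s i = -1 \<or> s i = 1"
  by (auto simp: signs_def)

lemma sum_signs_Suc:
  "(\<Sum>s\<in>signs (Suc n). G s) = (\<Sum>s\<in>signs n. G (s(n := 1)) + G (s(n := -1)) :: real)"
proof -
  have inj: "inj_on (\<lambda>(y, g). g(n := y)) ({-1, 1::real} \<times> signs n)"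
    unfolding signs_def by (rule inj_combinator) simp
  have "signs (Suc n) = (\<lambda>(y, g). g(n := y)) ` ({-1, 1} \<times> signs n)"
    unfolding signs_def lessThan_Suc by (rule PiE_insert_eq)
  then have "(\<Sum>s\<in>signs (Suc n). G s) = (\<Sum>(y, g)\<in>{-1, 1} \<times> signs n. G (g(n := y)))"
    using inj by (simp add: sum.reindex comp_def case_prod_unfold)
  also have "\<dots> = (\<Sum>s\<in>signs n. G (s(n := 1)) + G (s(n := -1)))"
    unfolding sum.cartesian_product[symmetric] by (simp add: sum.distrib)
  finally show ?thesis .
qed

text \<open>Negation need not preserve \<open>signs n\<close>, whose members are
  \<open>undefined\<close> from \<open>n\<close> onwards; hence the requirement that
  \<open>G\<close> look only at the first \<open>n\<close> values.\<close>

lemma sum_signs_uminus: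
  assumes "\<And>s s'. (\<And>i. i < n \<Longrightarrow> s i = s' i) \<Longrightarrow> G s = G s'"
  shows "(\<Sum>s\<in>signs n. G (\<lambda>i. - s i)) = (\<Sum>s\<in>signs n. G s :: real)"
proof -
  have "bij_betw (\<lambda>s. \<lambda>i\<in>{..<n}. - s i) (signs n) (signs n)"
    by (rule bij_betw_byWitness[where f' = "\<lambda>s. \<lambda>i\<in>{..<n}. - s i"])
      (auto simp: signs_def fun_eq_iff PiE_def extensional_def)
  then have "(\<Sum>s\<in>signs n. G s) = (\<Sum>s\<in>signs n. G (\<lambda>i\<in>{..<n}. - s i))"
    by (rule sum.reindex_bij_betw[symmetric])
  also have "\<dots> = (\<Sum>s\<in>signs n. G (\<lambda>i. - s i))"
    by (intro sum.cong refl assms) auto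
  finally show ?thesis by simp
qed

lemma sum_signs_eq_0: "i < n \<Longrightarrow> (\<Sum>s\<in>signs n. s i) = 0"
  using sum_signs_uminus[of n "\<lambda>s. s i"] by (simp add: sum_negf)

lemma MAX_attained:
  assumes "finite T" "T \<noteq> {}"
  shows "\<exists>\<tau>\<in>T. (MAX \<tau>\<in>T. g \<tau>) = g \<tau>"
proof -
  have "Max (g ` T) \<in> g ` T"
    using assms by (intro Max_in) auto
  then show ?thesis by blast
qed

text \<open>One step of the contraction principle of Ledoux and Talagrand for \<open>exp\<close>.
  The maximisers of the two terms on the left compete in both maxima on the right, and by
  \<open>contraction_step\<close> one of the two assignments suffices.\<close>

lemma exp_MAX_contraction:
  fixes u p q :: "'t \<Rightarrow> real"
  assumes T: "finite T" "T \<noteq> {}"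
    and pq: "\<And>\<tau> \<tau>'. \<tau> \<in> T \<Longrightarrow> \<tau>' \<in> T \<Longrightarrow> \<bar>p \<tau> - p \<tau>'\<bar> \<le> \<bar>q \<tau> - q \<tau>'\<bar>"
    and pq0: "\<And>\<tau>. \<tau> \<in> T \<Longrightarrow> \<bar>p \<tau>\<bar> \<le> \<bar>q \<tau>\<bar>"
  shows "exp (MAX \<tau>\<in>T. u \<tau> + p \<tau>) + exp (MAX \<tau>\<in>T. u \<tau> - p \<tau>)
    \<le> exp (MAX \<tau>\<in>T. u \<tau> + q \<tau>) + exp (MAX \<tau>\<in>T. u \<tau> - q \<tau>)"
proof -
  have le: "g \<tau> \<le> (MAX \<tau>\<in>T. g \<tau>)" if "\<tau> \<in> T" for g :: "'t \<Rightarrow> real" and \<tau>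
    using T that by simp
  obtain \<tau>\<^sub>1 where \<tau>\<^sub>1: "\<tau>\<^sub>1 \<in> T" "(MAX \<tau>\<in>T. u \<tau> + p \<tau>) = u \<tau>\<^sub>1 + p \<tau>\<^sub>1"
    using MAX_attained[OF T] by blast
  obtain \<tau>\<^sub>2 where \<tau>\<^sub>2: "\<tau>\<^sub>2 \<in> T" "(MAX \<tau>\<in>T. u \<tau> - p \<tau>) = u \<tau>\<^sub>2 - p \<tau>\<^sub>2"
    using MAX_attained[OF T] by blast
  have *: "exp (u \<tau>\<^sub>1 + p \<tau>\<^sub>1) + exp (u \<tau>\<^sub>2 - p \<tau>\<^sub>2) \<le> exp (u \<tau>\<^sub>1 + q \<tau>\<^sub>1) + exp (u \<tau>\<^sub>2 - q \<tau>\<^sub>2) \<or>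
    exp (u \<tau>\<^sub>1 + p \<tau>\<^sub>1) + exp (u \<tau>\<^sub>2 - p \<tau>\<^sub>2) \<le> exp (u \<tau>\<^sub>1 - q \<tau>\<^sub>1) + exp (u \<tau>\<^sub>2 + q \<tau>\<^sub>2)"
    using le[OF \<tau>\<^sub>2(1), of "\<lambda>\<tau>. u \<tau> + p \<tau>"] le[OF \<tau>\<^sub>1(1), of "\<lambda>\<tau>. u \<tau> - p \<tau>"] \<tau>\<^sub>1 \<tau>\<^sub>2
    by (intro contraction_step pq pq0) auto
  have up: "exp (u \<tau> + q \<tau>) \<le> exp (MAX \<tau>\<in>T. u \<tau> + q \<tau>)"
    "exp (u \<tau> - q \<tau>) \<le> exp (MAX \<tau>\<in>T. u \<tau> - q \<tau>)" if "\<tau> \<in> T" for \<tau>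
    using le[OF that, of "\<lambda>\<tau>. u \<tau> + q \<tau>"] le[OF that, of "\<lambda>\<tau>. u \<tau> - q \<tau>"] by auto
  show ?thesis
    using * up[OF \<tau>\<^sub>1(1)] up[OF \<tau>\<^sub>2(1)] unfolding \<tau>\<^sub>1(2) \<tau>\<^sub>2(2) by linarith
qed

lemma sum_signs_exp_contraction:
  fixes u :: "'t \<Rightarrow> real" and p q :: "nat \<Rightarrow> 't \<Rightarrow> real"
  assumes T: "finite T" "T \<noteq> {}"
    and pq: "\<And>i \<tau> \<tau>'. i < n \<Longrightarrow> \<tau> \<in> T \<Longrightarrow> \<tau>' \<in> T \<Longrightarrow> \<bar>p i \<tau> - p i \<tau>'\<bar> \<le> \<bar>q i \<tau> - q i \<tau>'\<bar>"
    and pq0: "\<And>i \<tau>. i < n \<Longrightarrow> \<tau> \<in> T \<Longrightarrow> \<bar>p i \<tau>\<bar> \<le> \<bar>q i \<tau>\<bar>"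
  shows "(\<Sum>s\<in>signs n. exp (MAX \<tau>\<in>T. u \<tau> + (\<Sum>i<n. s i * p i \<tau>)))
    \<le> (\<Sum>s\<in>signs n. exp (MAX \<tau>\<in>T. u \<tau> + (\<Sum>i<n. s i * q i \<tau>)))"
  using pq pq0
proof (induction n arbitrary: u)
  case 0
  then show ?case by simp
next
  case (Suc n)
  let ?S = "\<lambda>s r \<tau>. \<Sum>i<n. s i * r i \<tau>"
  have split: "(\<Sum>s\<in>signs (Suc n). exp (MAX \<tau>\<in>T. u \<tau> + (\<Sum>i<Suc n. s i * r i \<tau>))) =
    (\<Sum>s\<in>signs n. exp (MAX \<tau>\<in>T. (u \<tau> + ?S s r \<tau>) + r n \<tau>) + exp (MAX \<tau>\<in>T. (u \<tau> + ?S s r \<tau>) - r n \<tau>))" for r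
    unfolding sum_signs_Suc by (simp add: add.assoc diff_conv_add_uminus del: add_uminus_conv_diff)
  \<comment> \<open>Once \<open>p n\<close> is replaced by \<open>q n\<close>, the last term is
    absorbed into the offset with either sign, which is why the induction keeps \<open>u\<close>
    arbitrary.\<close>
  have swap: "(MAX \<tau>\<in>T. (u \<tau> + a \<tau>) + q n \<tau>) = (MAX \<tau>\<in>T. (u \<tau> + q n \<tau>) + a \<tau>)"
    "(MAX \<tau>\<in>T. (u \<tau> + a \<tau>) - q n \<tau>) = (MAX \<tau>\<in>T. (u \<tau> - q n \<tau>) + a \<tau>)" for a
    by (intro arg_cong[where f = Max] image_cong; simp)+
  have "(\<Sum>s\<in>signs (Suc n). exp (MAX \<tau>\<in>T. u \<tau> + (\<Sum>i<Suc n. s i * p i \<tau>)))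
    \<le> (\<Sum>s\<in>signs n. exp (MAX \<tau>\<in>T. (u \<tau> + ?S s p \<tau>) + q n \<tau>) + exp (MAX \<tau>\<in>T. (u \<tau> + ?S s p \<tau>) - q n \<tau>))"
    unfolding split by (intro sum_mono exp_MAX_contraction T Suc.prems) simp_all
  also have "\<dots> = (\<Sum>s\<in>signs n. exp (MAX \<tau>\<in>T. (u \<tau> + q n \<tau>) + ?S s p \<tau>)) +
      (\<Sum>s\<in>signs n. exp (MAX \<tau>\<in>T. (u \<tau> - q n \<tau>) + ?S s p \<tau>))"
    by (simp only: sum.distrib swap)
  also have "\<dots> \<le> (\<Sum>s\<in>signs n. exp (MAX \<tau>\<in>T. (u \<tau> + q n \<tau>) + ?S s q \<tau>)) +
      (\<Sum>s\<in>signs n. exp (MAX \<tau>\<in>T. (u \<tau> - q n \<tau>) + ?S s q \<tau>))"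
    by (intro add_mono Suc.IH Suc.prems) simp_all
  also have "\<dots> = (\<Sum>s\<in>signs (Suc n). exp (MAX \<tau>\<in>T. u \<tau> + (\<Sum>i<Suc n. s i * q i \<tau>)))"
    unfolding split by (simp only: sum.distrib swap)
  finally show ?case .
qed

lemma sum_signs_exp_le: "(\<Sum>s\<in>signs n. exp (\<Sum>i<n. s i * y i)) \<le> 2 ^ n * exp ((\<Sum>i<n. (y i)\<^sup>2) / 2)"
proof (induction n)
  case 0
  then show ?case by (simp add: signs_def)
next
  case (Suc n)
  have "(\<Sum>s\<in>signs (Suc n). exp (\<Sum>i<Suc n. s i * y i)) =
      (\<Sum>s\<in>signs n. exp (\<Sum>i<n. s i * y i)) * (exp (y n) + exp (- y n))"
    unfolding sum_signs_Suc by (simp add: exp_add exp_diff exp_minus sum_distrib_right distrib_left divide_inverse sum.distrib)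
  also have "\<dots> \<le> (2 ^ n * exp ((\<Sum>i<n. (y i)\<^sup>2) / 2)) * (2 * exp ((y n)\<^sup>2 / 2))"
    by (intro mult_mono Suc.IH exp_le_cosh_bound) (auto intro: sum_nonneg add_nonneg_nonneg)
  also have "\<dots> = 2 ^ Suc n * exp ((\<Sum>i<Suc n. (y i)\<^sup>2) / 2)"
    by (simp add: add_divide_distrib flip: exp_add)
  finally show ?case .
qed

section \<open>Exponential moments over balls of path variation\<close>

lemma exp_abs_le: "exp \<bar>x\<bar> \<le> exp (x::real) + exp (- x)"
  by (cases "0 \<le> x") auto

text \<open>Duality of the l1 norm and the maximum norm, used for the input weights and for the
  outer weights of a hidden layer.\<close>

lemma sum_mult_le_bound:
  fixes b A :: "'j \<Rightarrow> real"
  assumes "(\<Sum>j\<in>J. \<bar>b j\<bar>) \<le> v" "\<And>j. j \<in> J \<Longrightarrow> \<bar>A j\<bar> \<le> m" "0 \<le> m"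
  shows "(\<Sum>j\<in>J. b j * A j) \<le> v * m"
proof -
  have "(\<Sum>j\<in>J. b j * A j) \<le> (\<Sum>j\<in>J. \<bar>b j\<bar> * m)"
  proof (intro sum_mono)
    fix j assume "j \<in> J"
    have "b j * A j \<le> \<bar>b j\<bar> * \<bar>A j\<bar>"
      by (simp flip: abs_mult)
    also have "\<dots> \<le> \<bar>b j\<bar> * m"
      using assms(2)[OF \<open>j \<in> J\<close>] by (simp add: mult_left_mono)
    finally show "b j * A j \<le> \<bar>b j\<bar> * m" .
  qed
  also have "\<dots> \<le> v * m"
    using assms by (simp add: mult_right_mono flip: sum_distrib_right)
  finally show ?thesis .
qed

text \<open>Normal form of networks: the positive part is positively homogeneous, so the whole
  budget \<open>V\<close> can be moved to the input weights, leaving every later layer with absolute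
  weights of sum at most 1. Each \<open>z j\<close> is an arbitrary member of the ball below, so the
  layers can be peeled off one at a time.\<close>

primrec path_ball :: "real \<Rightarrow> nat \<Rightarrow> (real ^ 'd::finite \<Rightarrow> real) set" where
  "path_ball V 0 = {\<lambda>x. \<Sum>k\<in>UNIV. a k * x $ k | a. (\<Sum>k\<in>UNIV. \<bar>a k\<bar>) \<le> V}"
| "path_ball V (Suc h) =
    {\<lambda>x. \<Sum>j<m. b j * max (z j x) 0 | (m::nat) b z. (\<Sum>j<m. \<bar>b j\<bar>) \<le> 1 \<and> (\<forall>j<m. z j \<in> path_ball V h)}"

lemma zero_in_path_ball:
  assumes "0 \<le> V"
  shows "(\<lambda>x. 0) \<in> path_ball V h"
proof (cases h)
  case 0
  then show ?thesis using assms by (auto intro!: exI[of _ "\<lambda>_. 0"])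
next
  case (Suc h')
  then show ?thesis by (auto intro!: exI[of _ 0])
qed

text \<open>A linear form on the l1 ball of radius \<open>V\<close> is at most \<open>V\<close>
  times its largest coefficient in modulus. Replacing that maximum by a sum over the coordinates and
  both signs gives \<open>2 * CARD('d)\<close> exponentials, each sub-Gaussian because inputs are at
  most 1 in modulus.\<close>

lemma sum_signs_exp_linear:
  fixes T :: "(real ^ 'd::finite \<Rightarrow> real) set"
  assumes T: "finite T" "T \<noteq> {}" "T \<subseteq> path_ball V 0" and V: "0 \<le> V"
    and x: "\<And>i. i < n \<Longrightarrow> x i \<in> unit_cube"
  shows "(\<Sum>s\<in>signs n. exp (MAX f\<in>T. \<Sum>i<n. s i * (c i * f (x i))))
    \<le> 2 ^ n * (2 * real CARD('d) * exp (V\<^sup>2 * (\<Sum>i<n. (c i)\<^sup>2) / 2))"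
proof -
  let ?A = "\<lambda>s k. \<Sum>i<n. s i * (c i * x i $ k)"
  have "exp (MAX f\<in>T. \<Sum>i<n. s i * (c i * f (x i)))
      \<le> (\<Sum>k\<in>UNIV. exp (V * ?A s k) + exp (- (V * ?A s k)))" for s
  proof -
    obtain f where f: "f \<in> T" "(MAX f\<in>T. \<Sum>i<n. s i * (c i * f (x i))) = (\<Sum>i<n. s i * (c i * f (x i)))"
      using MAX_attained[OF T(1,2)] by blast
    then obtain a where a: "(\<Sum>k\<in>UNIV. \<bar>a k\<bar>) \<le> V" "f = (\<lambda>x. \<Sum>k\<in>UNIV. a k * x $ k)"
      using T by auto
    obtain l where l: "(MAX k\<in>UNIV. \<bar>?A s k\<bar>) = \<bar>?A s l\<bar>"
      using MAX_attained[of UNIV "\<lambda>k. \<bar>?A s k\<bar>"] by auto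
    have "(\<Sum>i<n. s i * (c i * f (x i))) = (\<Sum>k\<in>UNIV. a k * ?A s k)"
      unfolding a(2) sum_distrib_left by (subst sum.swap) (simp add: mult_ac)
    also have "\<dots> \<le> V * \<bar>?A s l\<bar>"
      using a(1) unfolding l[symmetric]
      by (intro sum_mult_le_bound) (auto simp: Max_ge_iff intro: Max_ge)
    also have "\<dots> = \<bar>V * ?A s l\<bar>"
      using V by (simp add: abs_mult)
    finally have "exp (\<Sum>i<n. s i * (c i * f (x i))) \<le> exp \<bar>V * ?A s l\<bar>"
      by simp
    also have "\<dots> \<le> exp (V * ?A s l) + exp (- (V * ?A s l))"
      by (rule exp_abs_le)
    also have "\<dots> \<le> (\<Sum>k\<in>UNIV. exp (V * ?A s k) + exp (- (V * ?A s k)))"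
      by (rule member_le_sum) (auto intro: add_nonneg_nonneg)
    finally show ?thesis unfolding f(2) .
  qed
  then have "(\<Sum>s\<in>signs n. exp (MAX f\<in>T. \<Sum>i<n. s i * (c i * f (x i))))
      \<le> (\<Sum>s\<in>signs n. \<Sum>k\<in>UNIV. exp (V * ?A s k) + exp (- (V * ?A s k)))"
    by (intro sum_mono)
  also have "\<dots> = (\<Sum>k\<in>UNIV. (\<Sum>s\<in>signs n. exp (V * ?A s k)) + (\<Sum>s\<in>signs n. exp (- (V * ?A s k))))"
    by (subst sum.swap) (simp add: sum.distrib)
  also have "\<dots> \<le> (\<Sum>k\<in>(UNIV::'d set). 2 ^ n * (2 * exp (V\<^sup>2 * (\<Sum>i<n. (c i)\<^sup>2) / 2)))"
  proof (intro sum_mono)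
    fix k :: 'd
    \<comment> \<open>\<open>v\<close> stands for both \<open>V\<close> and
      \<open>- V\<close>.\<close>
    have "(\<Sum>s\<in>signs n. exp (v * ?A s k)) \<le> 2 ^ n * exp (V\<^sup>2 * (\<Sum>i<n. (c i)\<^sup>2) / 2)" if "v\<^sup>2 = V\<^sup>2" for v
    proof -
      have "(\<Sum>s\<in>signs n. exp (v * ?A s k)) = (\<Sum>s\<in>signs n. exp (\<Sum>i<n. s i * (v * c i * x i $ k)))"
        by (simp add: sum_distrib_left mult_ac)
      also have "\<dots> \<le> 2 ^ n * exp ((\<Sum>i<n. (v * c i * x i $ k)\<^sup>2) / 2)"
        by (rule sum_signs_exp_le)
      also have "(\<Sum>i<n. (v * c i * x i $ k)\<^sup>2) \<le> (\<Sum>i<n. V\<^sup>2 * (c i)\<^sup>2)"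
      proof (intro sum_mono)
        fix i assume "i \<in> {..<n}"
        then have "\<bar>x i $ k\<bar> \<le> 1"
          using x[of i] by (auto simp: unit_cube_def abs_le_iff)
        then have "V\<^sup>2 * (c i)\<^sup>2 * (x i $ k)\<^sup>2 \<le> V\<^sup>2 * (c i)\<^sup>2 * 1"
          by (intro mult_left_mono) (auto simp: abs_square_le_1)
        then show "(v * c i * x i $ k)\<^sup>2 \<le> V\<^sup>2 * (c i)\<^sup>2"
          by (simp add: power_mult_distrib that)
      qed
      finally show ?thesis by (simp add: sum_distrib_left)
    qed
    from this[of V] this[of "- V"]
    show "(\<Sum>s\<in>signs n. exp (V * ?A s k)) + (\<Sum>s\<in>signs n. exp (- (V * ?A s k)))
        \<le> 2 ^ n * (2 * exp (V\<^sup>2 * (\<Sum>i<n. (c i)\<^sup>2) / 2))"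
      by (simp del: sum_negf)
  qed
  finally show ?thesis by (simp add: mult_ac)
qed

text \<open>Induction on the number of hidden layers. A signed sub-convex combination of positive
  parts is at most the largest modulus among them; the modulus costs a factor 2 through
  \<open>exp_abs_le\<close>, and contraction removes the positive part at no cost, since
  \<open>max y 0\<close> is 1-Lipschitz and vanishes at 0.\<close>

lemma sum_signs_exp_path_ball:
  fixes T :: "(real ^ 'd::finite \<Rightarrow> real) set"
  assumes T: "finite T" "T \<noteq> {}" "T \<subseteq> path_ball V h" and V: "0 \<le> V"
    and x: "\<And>i. i < n \<Longrightarrow> x i \<in> unit_cube"
  shows "(\<Sum>s\<in>signs n. exp (MAX f\<in>T. \<Sum>i<n. s i * (c i * f (x i))))
    \<le> 2 ^ n * (2 ^ h * (2 * real CARD('d)) * exp (V\<^sup>2 * (\<Sum>i<n. (c i)\<^sup>2) / 2))"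
  using T
proof (induction h arbitrary: T)
  case 0
  then show ?case
    using sum_signs_exp_linear[where T = T and V = V and n = n and x = x and c = c] V x by simp
next
  case (Suc h)
  let ?R = "\<lambda>s z. \<Sum>i<n. s i * (c i * max (z (x i)) 0)"
  \<comment> \<open>\<open>W\<close> holds the finitely many inner networks that \<open>f\<close>
    uses. The condition \<open>0 \<le> B\<close> matters when \<open>f\<close> is an empty
    sum.\<close>
  have "\<exists>W. finite W \<and> W \<subseteq> path_ball V h \<and>
      (\<forall>s B. 0 \<le> B \<longrightarrow> (\<forall>z\<in>W. \<bar>?R s z\<bar> \<le> B) \<longrightarrow> (\<Sum>i<n. s i * (c i * f (x i))) \<le> B)"
    if "f \<in> T" for f
  proof -
    have "f \<in> path_ball V (Suc h)" using Suc.prems that by blast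
    then obtain m :: nat and b z where b: "(\<Sum>j<m. \<bar>b j\<bar>) \<le> 1" and z: "\<forall>j<m. z j \<in> path_ball V h"
      and f: "f = (\<lambda>x. \<Sum>j<m. b j * max (z j x) 0)"
      unfolding path_ball.simps by blast
    have "(\<Sum>i<n. s i * (c i * f (x i))) \<le> B" if "0 \<le> B" "\<forall>z\<in>z ` {..<m}. \<bar>?R s z\<bar> \<le> B" for s B
    proof -
      have "(\<Sum>i<n. s i * (c i * f (x i))) = (\<Sum>i<n. \<Sum>j<m. b j * (s i * (c i * max (z j (x i)) 0)))"
        unfolding f sum_distrib_left by (intro sum.cong refl) (simp only: mult_ac)
      also have "\<dots> = (\<Sum>j<m. b j * ?R s (z j))"
        by (subst sum.swap) (simp only: sum_distrib_left)
      also have "\<dots> \<le> 1 * B"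
        using that by (intro sum_mult_le_bound b) auto
      finally show ?thesis by simp
    qed
    then show ?thesis
      using z by (intro exI[of _ "z ` {..<m}"]) blast
  qed
  then have "\<exists>W. \<forall>f\<in>T. finite (W f) \<and> W f \<subseteq> path_ball V h \<and>
      (\<forall>s B. 0 \<le> B \<longrightarrow> (\<forall>z\<in>W f. \<bar>?R s z\<bar> \<le> B) \<longrightarrow> (\<Sum>i<n. s i * (c i * f (x i))) \<le> B)"
    by (intro bchoice ballI)
  then obtain W where W: "\<forall>f\<in>T. finite (W f) \<and> W f \<subseteq> path_ball V h \<and>
      (\<forall>s B. 0 \<le> B \<longrightarrow> (\<forall>z\<in>W f. \<bar>?R s z\<bar> \<le> B) \<longrightarrow> (\<Sum>i<n. s i * (c i * f (x i))) \<le> B)"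
    by (elim exE)
  \<comment> \<open>The zero function keeps \<open>Z\<close> nonempty, as the maxima over it
    require, even if every \<open>W f\<close> is empty.\<close>
  define Z where "Z = insert (\<lambda>x. 0) (\<Union>f\<in>T. W f)"
  have Z: "finite Z" "Z \<noteq> {}" "Z \<subseteq> path_ball V h"
    using Suc.prems(1) W zero_in_path_ball[OF V] unfolding Z_def by blast+
  have "exp (MAX f\<in>T. \<Sum>i<n. s i * (c i * f (x i)))
      \<le> exp (MAX z\<in>Z. ?R s z) + exp (MAX z\<in>Z. ?R (\<lambda>i. - s i) z)" for s
  proof -
    obtain f where f: "f \<in> T" "(MAX f\<in>T. \<Sum>i<n. s i * (c i * f (x i))) = (\<Sum>i<n. s i * (c i * f (x i)))"
      using MAX_attained[OF Suc.prems(1,2)] by blast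
    obtain w where w: "w \<in> Z" "(MAX z\<in>Z. \<bar>?R s z\<bar>) = \<bar>?R s w\<bar>"
      using MAX_attained[OF Z(1,2)] by blast
    have le: "(\<Sum>i<n. s i * (c i * f (x i))) \<le> \<bar>?R s w\<bar>"
    proof (rule W[rule_format, OF f(1), THEN conjunct2, THEN conjunct2, rule_format, OF abs_ge_zero])
      fix z assume "z \<in> W f"
      then have "z \<in> Z" using f(1) by (auto simp: Z_def)
      then show "\<bar>?R s z\<bar> \<le> \<bar>?R s w\<bar>"
        unfolding w(2)[symmetric] using Z(1) by (intro Max_ge) auto
    qed
    have "?R s' w \<le> (MAX z\<in>Z. ?R s' z)" for s'
      by (rule Max_ge[OF finite_imageI[OF Z(1)] imageI[OF w(1)]])
    note R_le = this[of s] this[of "\<lambda>i. - s i"]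
    have "?R (\<lambda>i. - s i) w = - ?R s w"
      by (simp add: sum_negf)
    then have "exp (?R s w) \<le> exp (MAX z\<in>Z. ?R s z)"
      "exp (- ?R s w) \<le> exp (MAX z\<in>Z. ?R (\<lambda>i. - s i) z)"
      using R_le by simp_all
    moreover have "exp (\<Sum>i<n. s i * (c i * f (x i))) \<le> exp \<bar>?R s w\<bar>"
      using le by simp
    ultimately show ?thesis
      unfolding f(2) using exp_abs_le[of "?R s w"] by linarith
  qed
  then have "(\<Sum>s\<in>signs n. exp (MAX f\<in>T. \<Sum>i<n. s i * (c i * f (x i))))
      \<le> (\<Sum>s\<in>signs n. exp (MAX z\<in>Z. ?R s z)) + (\<Sum>s\<in>signs n. exp (MAX z\<in>Z. ?R (\<lambda>i. - s i) z))"
    unfolding sum.distrib[symmetric] by (rule sum_mono)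
  \<comment> \<open>Flipping all signs below \<open>n\<close> permutes the sign vectors, so the two
    sums agree: this is the factor 2 of the layer.\<close>
  also have "(\<Sum>s\<in>signs n. exp (MAX z\<in>Z. ?R (\<lambda>i. - s i) z)) = (\<Sum>s\<in>signs n. exp (MAX z\<in>Z. ?R s z))"
    by (rule sum_signs_uminus) simp
  also have "(\<Sum>s\<in>signs n. exp (MAX z\<in>Z. ?R s z)) \<le> (\<Sum>s\<in>signs n. exp (MAX z\<in>Z. \<Sum>i<n. s i * (c i * z (x i))))"
  proof -
    have "\<bar>c i * max y 0 - c i * max y' 0\<bar> \<le> \<bar>c i * y - c i * y'\<bar>" for i y y'
      by (simp only: abs_mult flip: right_diff_distrib) (intro mult_left_mono; simp)
    moreover have "\<bar>c i * max y 0\<bar> \<le> \<bar>c i * y\<bar>" for i y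
      by (simp only: abs_mult) (intro mult_left_mono; simp)
    ultimately have "(\<Sum>s\<in>signs n. exp (MAX z\<in>Z. 0 + ?R s z))
        \<le> (\<Sum>s\<in>signs n. exp (MAX z\<in>Z. 0 + (\<Sum>i<n. s i * (c i * z (x i)))))"
      by (intro sum_signs_exp_contraction Z)
    then show ?thesis by simp
  qed
  also have "\<dots> \<le> 2 ^ n * (2 ^ h * (2 * real CARD('d)) * exp (V\<^sup>2 * (\<Sum>i<n. (c i)\<^sup>2) / 2))"
    by (rule Suc.IH[OF Z])
  finally show ?case by (simp add: mult_ac)
qed

text \<open>The networks \<open>g s\<close> may depend on the signs, so this bounds an average of
  suprema while only the finite range of \<open>g\<close> enters. Jensen's inequality passes to the
  exponential moment at \<open>\<theta>\<close>; taking logarithms and dividing by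
  \<open>\<theta>\<close> turns the factors \<open>2 ^ h\<close> and \<open>2 * CARD('d)\<close>
  into the numerator of the first term.\<close>

lemma sum_signs_path_ball_le:
  fixes g :: "(nat \<Rightarrow> real) \<Rightarrow> real ^ 'd::finite \<Rightarrow> real"
  assumes V: "0 \<le> V" and \<theta>: "0 < \<theta>"
    and x: "\<And>i. i < n \<Longrightarrow> x i \<in> unit_cube"
    and \<psi>: "\<And>i y y'. i < n \<Longrightarrow> \<bar>\<psi> i y - \<psi> i y'\<bar> \<le> \<bar>y - y'\<bar>"
    and g: "\<And>s. s \<in> signs n \<Longrightarrow> g s \<in> path_ball V h"
  shows "(\<Sum>s\<in>signs n. \<Sum>i<n. s i * (c i * \<psi> i (g s (x i)))) / 2 ^ n
    \<le> (real h * ln 2 + ln (2 * real CARD('d))) / \<theta> + \<theta> * V\<^sup>2 * (\<Sum>i<n. (c i)\<^sup>2) / 2"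
proof -
  let ?T = "g ` signs n"
  \<comment> \<open>Contraction asks for domination in modulus and not only in differences, so each
    \<open>\<psi> i\<close> is centred at 0; the subtracted constants average out over the
    signs.\<close>
  let ?p = "\<lambda>i f. \<theta> * c i * (\<psi> i (f (x i)) - \<psi> i 0)"
  let ?a = "\<lambda>s. \<Sum>i<n. s i * ?p i (g s)"
  let ?E = "2 ^ h * (2 * real CARD('d)) * exp (V\<^sup>2 * (\<Sum>i<n. (\<theta> * c i)\<^sup>2) / 2)"
  have T: "finite ?T" "?T \<noteq> {}" "?T \<subseteq> path_ball V h"
    using g by auto
  have "(\<Sum>s\<in>signs n. \<Sum>i<n. s i * (c i * \<psi> i 0)) = 0"
    by (subst sum.swap) (simp add: sum_signs_eq_0 flip: sum_distrib_right)
  then have shift: "(\<Sum>s\<in>signs n. \<Sum>i<n. s i * (c i * (\<psi> i (g s (x i)) - \<psi> i 0))) =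
      (\<Sum>s\<in>signs n. \<Sum>i<n. s i * (c i * \<psi> i (g s (x i))))"
    by (simp only: right_diff_distrib sum_subtractf)
  have a: "\<theta> * (\<Sum>s\<in>signs n. \<Sum>i<n. s i * (c i * \<psi> i (g s (x i)))) = (\<Sum>s\<in>signs n. ?a s)"
    unfolding shift[symmetric] by (simp only: sum_distrib_left mult_ac)
  have "exp (\<Sum>s\<in>signs n. (1 / 2 ^ n) *\<^sub>R ?a s) \<le> (\<Sum>s\<in>signs n. (1 / 2 ^ n) * exp (?a s))"
    using convex_on_exp[of 1] by (intro convex_on_sum[where C = UNIV]) auto
  also have "\<dots> = (\<Sum>s\<in>signs n. exp (?a s)) / 2 ^ n"
    by (simp add: sum_divide_distrib)
  also have "(\<Sum>s\<in>signs n. exp (?a s)) \<le> (\<Sum>s\<in>signs n. exp (MAX f\<in>?T. 0 + (\<Sum>i<n. s i * ?p i f)))"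
    by (intro sum_mono) (auto intro!: Max_ge)
  also have "\<dots> \<le> (\<Sum>s\<in>signs n. exp (MAX f\<in>?T. 0 + (\<Sum>i<n. s i * (\<theta> * c i * f (x i)))))"
    using \<psi> by (intro sum_signs_exp_contraction T)
      (auto simp: abs_mult mult_left_mono simp flip: right_diff_distrib, 
       metis \<psi> abs_ge_zero diff_zero mult_left_mono mult_nonneg_nonneg)
  also have "\<dots> \<le> 2 ^ n * ?E"
    using sum_signs_exp_path_ball[OF T V x, where c = "\<lambda>i. \<theta> * c i"] by simp
  finally have "exp ((\<Sum>s\<in>signs n. ?a s) / 2 ^ n) \<le> ?E"
    by (simp add: sum_divide_distrib divide_simps mult_ac)
  then have "(\<Sum>s\<in>signs n. ?a s) / 2 ^ n \<le> ln ?E"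
    by (subst ln_ge_iff) auto
  also have "ln ?E = real h * ln 2 + ln (2 * real CARD('d)) + \<theta>\<^sup>2 * V\<^sup>2 * (\<Sum>i<n. (c i)\<^sup>2) / 2"
    by (simp add: ln_mult_pos ln_realpow power_mult_distrib sum_distrib_left[symmetric])
  finally show ?thesis
    unfolding a[symmetric] using \<theta> by (simp add: field_simps power2_eq_square)
qed

section \<open>Path variation\<close>

text \<open>The path variation seen from a single unit, summed level by level over the paths that
  end there. This form matches the recursion of \<open>preactivation\<close>.\<close>

primrec unit_variation ::
  "(nat \<Rightarrow> nat) \<Rightarrow> (nat \<Rightarrow> nat \<Rightarrow> nat \<Rightarrow> real) \<Rightarrow> (nat \<Rightarrow> 'd::finite \<Rightarrow> real) \<Rightarrow> nat \<Rightarrow> nat \<Rightarrow> real" where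
  "unit_variation D w a 0 i = (\<Sum>k\<in>UNIV. \<bar>a i k\<bar>)"
| "unit_variation D w a (Suc h) i = (\<Sum>j<D h. \<bar>w h i j\<bar> * unit_variation D w a h j)"

text \<open>The weight \<open>G\<close> on the end point of a path makes the induction go through:
  removing the top level leaves shorter paths whose end point is weighted by the last edge.\<close>

lemma sum_paths_weighted:
  fixes D w and a :: "nat \<Rightarrow> 'd::finite \<Rightarrow> real" and G :: "nat \<Rightarrow> real"
  shows "(\<Sum>p\<in>(\<Pi>\<^sub>E h\<in>{..H}. {..<D h}).
      (\<Prod>h<H. \<bar>w h (p (Suc h)) (p h)\<bar>) * (\<Sum>k\<in>UNIV. \<bar>a (p 0) k\<bar>) * G (p H)) =
    (\<Sum>i<D H. unit_variation D w a H i * G i)"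
proof (induction H arbitrary: G)
  case 0
  have inj: "inj_on (\<lambda>(y, g). g(0 := y)) ({..<D 0} \<times> (\<Pi>\<^sub>E h\<in>{}. {..<D h}))"
    by (rule inj_combinator) simp
  have "(\<Pi>\<^sub>E h\<in>{..0}. {..<D h}) = (\<lambda>(y, g). g(0 := y)) ` ({..<D 0} \<times> (\<Pi>\<^sub>E h\<in>{}. {..<D h}))"
    using PiE_insert_eq[of 0 "{}" "\<lambda>h. {..<D h}"] by simp
  then have "(\<Sum>p\<in>(\<Pi>\<^sub>E h\<in>{..0}. {..<D h}). (\<Sum>k\<in>UNIV. \<bar>a (p 0) k\<bar>) * G (p 0)) =
      (\<Sum>(i, q)\<in>{..<D 0} \<times> (\<Pi>\<^sub>E h\<in>{}. {..<D h}). (\<Sum>k\<in>UNIV. \<bar>a i k\<bar>) * G i)"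
    using inj by (simp add: sum.reindex comp_def case_prod_unfold del: PiE_empty_domain)
  also have "\<dots> = (\<Sum>i<D 0. \<Sum>q\<in>(\<Pi>\<^sub>E h\<in>{}. {..<D h}). (\<Sum>k\<in>UNIV. \<bar>a i k\<bar>) * G i)"
    by (rule sum.cartesian_product[symmetric])
  finally show ?case by simp
next
  case (Suc H)
  let ?Q = "\<Pi>\<^sub>E h\<in>{..H}. {..<D h}"
  let ?c = "\<lambda>p. (\<Prod>h<H. \<bar>w h (p (Suc h)) (p h)\<bar>) * (\<Sum>k\<in>UNIV. \<bar>a (p 0) k\<bar>)"
  let ?F = "\<lambda>p. (\<Prod>h<Suc H. \<bar>w h (p (Suc h)) (p h)\<bar>) * (\<Sum>k\<in>UNIV. \<bar>a (p 0) k\<bar>) * G (p (Suc H))"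
  \<comment> \<open>The induction hypothesis at the weight
    \<open>\<lambda>j. \<bar>w H i j\<bar>\<close>.\<close>
  have IH: "(\<Sum>q\<in>?Q. ?c q * \<bar>w H i (q H)\<bar>) = (\<Sum>j<D H. unit_variation D w a H j * \<bar>w H i j\<bar>)" for i
    by (rule Suc.IH)
  have inj: "inj_on (\<lambda>(y, g). g(Suc H := y)) ({..<D (Suc H)} \<times> ?Q)"
    by (rule inj_combinator) simp
  have "(\<Pi>\<^sub>E h\<in>{..Suc H}. {..<D h}) = (\<lambda>(y, g). g(Suc H := y)) ` ({..<D (Suc H)} \<times> ?Q)"
    unfolding atMost_Suc by (rule PiE_insert_eq)
  then have "(\<Sum>p\<in>(\<Pi>\<^sub>E h\<in>{..Suc H}. {..<D h}). ?F p) =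
      (\<Sum>(i, q)\<in>{..<D (Suc H)} \<times> ?Q. ?F (q(Suc H := i)))"
    using inj by (simp add: sum.reindex comp_def case_prod_unfold del: prod.lessThan_Suc)
  also have "\<dots> = (\<Sum>i<D (Suc H). \<Sum>q\<in>?Q. ?F (q(Suc H := i)))"
    by (rule sum.cartesian_product[symmetric])
  also have "\<dots> = (\<Sum>i<D (Suc H). (\<Sum>q\<in>?Q. ?c q * \<bar>w H i (q H)\<bar>) * G i)"
    unfolding sum_distrib_right by (intro sum.cong refl) (simp add: mult_ac)
  also have "\<dots> = (\<Sum>i<D (Suc H). unit_variation D w a (Suc H) i * G i)"
    unfolding IH by (simp add: mult.commute)
  finally show ?case .
qed

lemma path_variation_eq_unit_variation:
  assumes "D H = 1"
  shows "path_variation D w a H = unit_variation D w a H 0"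
  using sum_paths_weighted[where H = H and D = D and w = w and a = a and G = "\<lambda>_. 1"] assms
  by (simp add: path_variation_def sum_distrib_left)

lemma unit_variation_nonneg: "0 \<le> unit_variation D w a h i"
  by (induction h arbitrary: i) (auto intro!: sum_nonneg)

text \<open>Covers the units of zero variation, which cannot be rescaled to variation
  \<open>V\<close>.\<close>

lemma preactivation_eq_0:
  "unit_variation D w a h i = 0 \<Longrightarrow> preactivation D w a h i x = 0"
proof (induction h arbitrary: i)
  case 0
  then show ?case by (simp add: sum_nonneg_eq_0_iff)
next
  case (Suc h)
  then have "\<forall>j<D h. \<bar>w h i j\<bar> * unit_variation D w a h j = 0"
    by (simp add: sum_nonneg_eq_0_iff unit_variation_nonneg)
  then show ?case
    using Suc.IH by (auto intro!: sum.neutral)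
qed

text \<open>By positive homogeneity a factor \<open>?v j / V\<close> can be pulled out of the
  positive part of unit \<open>j\<close>, which leaves an inner network of variation
  \<open>V\<close> and outer weights of absolute sum
  \<open>r * unit_variation D w a (Suc h) i / V\<close>. The free factor \<open>r\<close> serves the
  induction, where it becomes \<open>V / ?v j\<close>.\<close>

lemma scaled_preactivation_in_path_ball:
  assumes "0 < V" "0 \<le> r" "r * unit_variation D w a h i \<le> V"
  shows "(\<lambda>x. r * preactivation D w a h i x) \<in> path_ball V h"
  using assms(2,3)
proof (induction h arbitrary: r i)
  case 0
  then have "(\<Sum>k\<in>UNIV. \<bar>r * a i k\<bar>) \<le> V"
    by (simp add: abs_mult sum_distrib_left)
  then show ?case
    by (auto simp: sum_distrib_left mult.assoc intro!: exI[of _ "\<lambda>k. r * a i k"])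
next
  case (Suc h)
  let ?v = "unit_variation D w a h"
  \<comment> \<open>As \<open>V / 0 = 0\<close>, a unit of zero variation is represented by the zero
    function, with outer weight 0.\<close>
  let ?z = "\<lambda>j x. (V / ?v j) * preactivation D w a h j x"
  let ?b = "\<lambda>j. r * w h i j * ?v j / V"
  have "(\<Sum>j<D h. \<bar>?b j\<bar>) = r * unit_variation D w a (Suc h) i / V"
    using Suc.prems(1) assms(1)
    by (simp add: abs_mult unit_variation_nonneg sum_distrib_left sum_divide_distrib mult_ac)
  also have "\<dots> \<le> 1"
    using Suc.prems(2) assms(1) by simp
  finally have b: "(\<Sum>j<D h. \<bar>?b j\<bar>) \<le> 1" .
  have "?z j \<in> path_ball V h" for j
    using assms(1) unit_variation_nonneg[of D w a h j]
    by (intro Suc.IH) (auto simp: divide_simps)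
  moreover have "(\<lambda>x. r * preactivation D w a (Suc h) i x) = (\<lambda>x. \<Sum>j<D h. ?b j * max (?z j x) 0)"
  proof
    fix x
    have "r * (w h i j * max (preactivation D w a h j x) 0) = ?b j * max (?z j x) 0" for j
    proof (cases "?v j = 0")
      case True
      then show ?thesis by (simp add: preactivation_eq_0)
    next
      case False
      then have "0 < V / ?v j"
        using unit_variation_nonneg[of D w a h j] assms(1) by simp
      then have "max (?z j x) 0 = (V / ?v j) * max (preactivation D w a h j x) 0"
        by (simp add: max_mult_distrib_left)
      then show ?thesis
        using False assms(1) by simp
    qed
    then show "r * preactivation D w a (Suc h) i x = (\<Sum>j<D h. ?b j * max (?z j x) 0)"
      by (simp add: sum_distrib_left)
  qed
  ultimately show ?case
    unfolding path_ball.simps mem_Collect_eq using b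
    by (intro exI[of _ "D h"] exI[of _ ?b] exI[of _ ?z]) blast
qed

lemma relu_class_path_ball:
  assumes "f \<in> relu_class \<phi> L V" "0 < V"
  shows "\<exists>g\<in>path_ball V (L - 1). \<forall>x\<in>unit_cube. f x = \<phi> (g x)"
proof -
  obtain D w a where "D (L - 1) = 1" "path_variation D w a (L - 1) \<le> V"
    and f: "\<forall>x\<in>unit_cube. f x = \<phi> (preactivation D w a (L - 1) 0 x)"
    using assms(1) unfolding relu_class_def by blast
  then have "preactivation D w a (L - 1) 0 \<in> path_ball V (L - 1)"
    using scaled_preactivation_in_path_ball[of V 1 D w a "L - 1" 0] assms(2)
    by (simp add: path_variation_eq_unit_variation)
  then show ?thesis
    using f by blast
qed

section \<open>Continuity of networks and the retraction onto the cube\<close>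

lemma continuous_on_path_ball: "g \<in> path_ball V h \<Longrightarrow> continuous_on A g"
proof (induction h arbitrary: g)
  case 0
  then show ?case by (auto intro!: continuous_intros)
next
  case (Suc h)
  then obtain m :: nat and b z where z: "\<forall>j<m. z j \<in> path_ball V h"
    and g: "g = (\<lambda>x. \<Sum>j<m. b j * max (z j x) 0)"
    unfolding path_ball.simps by blast
  have "continuous_on A (z j)" if "j < m" for j
    using Suc.IH z that by blast
  then show ?case
    unfolding g by (intro continuous_intros) auto
qed

lemma unit_cube_eq_cbox: "unit_cube = cbox (-1) (1 :: real ^ 'd::finite)"
  by (auto simp: unit_cube_def mem_box_cart)

text \<open>Members of the class are constrained on the cube only. Composed with this continuous
  retraction they become continuous on the whole space, with unchanged values on the cube.\<close>

abbreviation cube_clamp :: "real ^ 'd::finite \<Rightarrow> real ^ 'd" where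
  "cube_clamp \<equiv> clamp (-1) 1"

lemma cube_clamp_in: "cube_clamp x \<in> unit_cube"
  unfolding unit_cube_eq_cbox by (rule clamp_in_interval) (auto simp: Basis_vec_def inner_axis)

lemma cube_clamp_id: "x \<in> unit_cube \<Longrightarrow> cube_clamp x = x"
  by (simp add: unit_cube_eq_cbox)

section \<open>Suprema over the network class\<close>

text \<open>A superlevel set of a supremum of continuous functions is a union of open sets, hence
  open; this holds for an uncountable \<open>F\<close> as well.\<close>

lemma borel_measurable_SUP_continuous:
  fixes h :: "'f \<Rightarrow> 'a::topological_space \<Rightarrow> real"
  assumes "F \<noteq> {}" and "\<And>f. f \<in> F \<Longrightarrow> continuous_on UNIV (h f)"
    and "\<And>x. bdd_above ((\<lambda>f. h f x) ` F)"
  shows "(\<lambda>x. SUP f\<in>F. h f x) \<in> borel_measurable borel"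
proof (rule borel_measurableI_greater)
  fix y
  have "{x \<in> space borel. y < (SUP f\<in>F. h f x)} = (\<Union>f\<in>F. {x. y < h f x})"
    using assms(1,3) by (auto simp: less_cSUP_iff)
  moreover have "open (\<Union>f\<in>F. {x. y < h f x})"
    using assms(2) by (intro open_UN ballI open_Collect_less) auto
  ultimately show "{x \<in> space borel. y < (SUP f\<in>F. h f x)} \<in> sets borel"
    by simp
qed

text \<open>Suprema over the class need not be attained. Selecting for each \<open>s\<close> a
  function within \<open>\<delta>\<close> of its supremum reduces the claim to selections
  \<open>g\<close>, the form handled by the sign averages above.\<close>

lemma sum_cSUP_le:
  fixes A :: "'s \<Rightarrow> 'f \<Rightarrow> real"
  assumes "finite S" "F \<noteq> {}" and bdd: "\<And>s. s \<in> S \<Longrightarrow> bdd_above (A s ` F)"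
    and le: "\<And>g. (\<And>s. s \<in> S \<Longrightarrow> g s \<in> F) \<Longrightarrow> (\<Sum>s\<in>S. A s (g s)) \<le> C"
  shows "(\<Sum>s\<in>S. SUP f\<in>F. A s f) \<le> C"
proof (rule field_le_epsilon)
  fix e :: real assume "0 < e"
  \<comment> \<open>The summand 1 keeps the denominator positive when \<open>S\<close> is
    empty.\<close>
  define \<delta> where "\<delta> = e / (real (card S) + 1)"
  have \<delta>: "0 < \<delta>" using \<open>0 < e\<close> by (simp add: \<delta>_def add_nonneg_pos)
  have "\<forall>s\<in>S. \<exists>f. f \<in> F \<and> (SUP f\<in>F. A s f) - \<delta> < A s f"
  proof
    fix s assume "s \<in> S"
    have "(SUP f\<in>F. A s f) - \<delta> < (SUP f\<in>F. A s f)" using \<delta> by simp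
    then show "\<exists>f. f \<in> F \<and> (SUP f\<in>F. A s f) - \<delta> < A s f"
      using less_cSUP_iff[OF \<open>F \<noteq> {}\<close> bdd[OF \<open>s \<in> S\<close>]] by blast
  qed
  from bchoice[OF this] obtain g where g: "\<forall>s\<in>S. g s \<in> F \<and> (SUP f\<in>F. A s f) - \<delta> < A s (g s)" ..
  have "(\<Sum>s\<in>S. SUP f\<in>F. A s f) \<le> (\<Sum>s\<in>S. A s (g s) + \<delta>)"
    using g by (intro sum_mono) (simp add: less_imp_le flip: diff_le_eq)
  also have "\<dots> = (\<Sum>s\<in>S. A s (g s)) + real (card S) * \<delta>"
    by (simp add: sum.distrib)
  also have "(\<Sum>s\<in>S. A s (g s)) \<le> C"
    using g by (intro le) blast
  also have "real (card S) * \<delta> \<le> e"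
    using \<open>0 < e\<close> by (simp add: \<delta>_def field_simps)
  finally show "(\<Sum>s\<in>S. SUP f\<in>F. A s f) \<le> C + e" by simp
qed

locale relu_regression =
  fixes \<phi> :: "real \<Rightarrow> real" and L :: nat and V B :: real and fstar :: "real ^ 'd::finite \<Rightarrow> real"
    and n :: nat
  assumes lipschitz: "1-lipschitz_on UNIV \<phi>" and V_pos: "0 < V" and B_pos: "0 < B"
    and fstar: "fstar \<in> bounded_relu_class \<phi> L V B"
begin

abbreviation F :: "(real ^ 'd \<Rightarrow> real) set" where
  "F \<equiv> bounded_relu_class \<phi> L V B"

abbreviation sq_err :: "(real ^ 'd \<Rightarrow> real) \<Rightarrow> real ^ 'd \<Rightarrow> real" where
  "sq_err f x \<equiv> (f x - fstar x)\<^sup>2"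

text \<open>The logarithm of the factor \<open>2 ^ (L - 1) * (2 * CARD('d))\<close> in the
  exponential moment; a network of \<open>L\<close> weight layers has \<open>L - 1\<close> layers of
  positive parts.\<close>

definition complexity :: real where
  "complexity = real (L - 1) * ln 2 + ln (2 * real CARD('d))"

lemma F_nonempty: "F \<noteq> {}"
  using fstar by blast

lemma F_bound: "f \<in> F \<Longrightarrow> x \<in> unit_cube \<Longrightarrow> \<bar>f x\<bar> \<le> B"
  by (simp add: bounded_relu_class_def)

lemma F_diff_bound:
  assumes "f \<in> F" "x \<in> unit_cube"
  shows "\<bar>f x - fstar x\<bar> \<le> 2 * B"
  using F_bound[OF assms] F_bound[OF fstar assms(2)] by linarith

lemma sq_err_bound:
  assumes "f \<in> F" "x \<in> unit_cube"
  shows "sq_err f x \<le> (2 * B)\<^sup>2"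
  using F_diff_bound[OF assms] by (rule abs_le_square_iff[THEN iffD1, OF order_trans]) simp

lemma F_path_ball:
  assumes "f \<in> F"
  shows "\<exists>g\<in>path_ball V (L - 1). \<forall>x\<in>unit_cube. f x = \<phi> (g x)"
  using assms relu_class_path_ball[OF _ V_pos] unfolding bounded_relu_class_def by blast

lemma phi_lipschitz: "\<bar>\<phi> y - \<phi> y'\<bar> \<le> \<bar>y - y'\<bar>"
  using lipschitz_onD[OF lipschitz, of y y'] by (simp add: dist_real_def)

lemma continuous_on_F:
  assumes "f \<in> F"
  shows "continuous_on unit_cube f"
proof -
  obtain g where g: "g \<in> path_ball V (L - 1)" "\<forall>x\<in>unit_cube. f x = \<phi> (g x)"
    using F_path_ball[OF assms] by blast
  have "continuous_on UNIV \<phi>"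
    using lipschitz by (rule lipschitz_on_continuous_on)
  then have "continuous_on unit_cube (\<lambda>x. \<phi> (g x))"
    using continuous_on_path_ball[OF g(1)] by (rule continuous_on_compose2) simp
  then show ?thesis
    using g(2) by (simp cong: continuous_on_cong)
qed

lemma continuous_F_clamp: "f \<in> F \<Longrightarrow> continuous_on A (\<lambda>x. f (cube_clamp x))"
  using continuous_on_F clamp_continuous_on unfolding unit_cube_eq_cbox by blast

text \<open>A square is Lipschitz on bounded sets only, so \<open>\<psi>\<close> is controlled just
  on the range allowed by \<open>B\<close>. Clipping to this range is 1-Lipschitz and fixes the
  values of members of \<open>F\<close> on the cube, so \<open>\<psi>\<close>, the clipping and
  \<open>\<phi>\<close> are contracted in one go.\<close>

lemma sum_signs_F_le:
  fixes g :: "(nat \<Rightarrow> real) \<Rightarrow> real ^ 'd \<Rightarrow> real"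
  assumes \<theta>: "0 < \<theta>" and x: "\<And>i. i < n \<Longrightarrow> x i \<in> unit_cube"
    and \<psi>: "\<And>i y y'. i < n \<Longrightarrow> \<bar>y\<bar> \<le> B \<Longrightarrow> \<bar>y'\<bar> \<le> B \<Longrightarrow> \<bar>\<psi> i y - \<psi> i y'\<bar> \<le> \<bar>y - y'\<bar>"
    and g: "\<And>s. s \<in> signs n \<Longrightarrow> g s \<in> F"
  shows "(\<Sum>s\<in>signs n. \<Sum>i<n. s i * (c i * \<psi> i (g s (x i))))
    \<le> 2 ^ n * (complexity / \<theta> + \<theta> * V\<^sup>2 * (\<Sum>i<n. (c i)\<^sup>2) / 2)"
proof -
  let ?clip = "\<lambda>y. max (- B) (min B y)"
  have clip: "\<bar>?clip y\<bar> \<le> B" "\<bar>?clip y - ?clip y'\<bar> \<le> \<bar>y - y'\<bar>" for y y'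
    using B_pos by auto
  have "\<forall>s\<in>signs n. \<exists>h. h \<in> path_ball V (L - 1) \<and> (\<forall>x\<in>unit_cube. g s x = \<phi> (h x))"
    using F_path_ball g by blast
  from bchoice[OF this] obtain h where
    h: "\<forall>s\<in>signs n. h s \<in> path_ball V (L - 1) \<and> (\<forall>x\<in>unit_cube. g s x = \<phi> (h s x))" ..
  have "(\<Sum>s\<in>signs n. \<Sum>i<n. s i * (c i * \<psi> i (g s (x i)))) =
      (\<Sum>s\<in>signs n. \<Sum>i<n. s i * (c i * \<psi> i (?clip (\<phi> (h s (x i))))))"
  proof (intro sum.cong refl)
    fix s i assume si: "s \<in> signs n" "i \<in> {..<n}"
    then have "g s (x i) = \<phi> (h s (x i))" "\<bar>g s (x i)\<bar> \<le> B"
      using h x F_bound[OF g] by auto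
    then show "s i * (c i * \<psi> i (g s (x i))) = s i * (c i * \<psi> i (?clip (\<phi> (h s (x i)))))"
      by (simp add: min_absorb2 max_absorb2 abs_le_iff)
  qed
  also have "\<dots> / 2 ^ n \<le> complexity / \<theta> + \<theta> * V\<^sup>2 * (\<Sum>i<n. (c i)\<^sup>2) / 2"
    unfolding complexity_def
  proof (rule sum_signs_path_ball_le[where \<psi> = "\<lambda>i y. \<psi> i (?clip (\<phi> y))"])
    fix i y y' assume "i < n"
    show "\<bar>\<psi> i (?clip (\<phi> y)) - \<psi> i (?clip (\<phi> y'))\<bar> \<le> \<bar>y - y'\<bar>"
      using \<psi>[OF \<open>i < n\<close> clip(1) clip(1)] clip(2) phi_lipschitz by (meson order_trans)
  qed (use V_pos \<theta> x h in auto)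
  finally show ?thesis by (simp add: field_simps)
qed

text \<open>Clamping the points makes this a supremum of continuous functions on the full product
  space, independent of how members of \<open>F\<close> are extended beyond the cube.\<close>

definition noise_sup :: "(nat \<Rightarrow> real) \<times> (nat \<Rightarrow> real ^ 'd) \<Rightarrow> real" where
  "noise_sup = (\<lambda>(e, x). SUP f\<in>F. \<Sum>i<n. e i * (f (cube_clamp (x i)) - fstar (cube_clamp (x i))))"

text \<open>The first \<open>n\<close> points are the sample and the next \<open>n\<close> points are the ghost sample.\<close>

definition ghost_sup :: "(nat \<Rightarrow> real) \<Rightarrow> (nat \<Rightarrow> real ^ 'd) \<Rightarrow> real" where
  "ghost_sup s x = (SUP f\<in>F. \<Sum>i<n. s i *
     (sq_err f (cube_clamp (x (n + i))) - sq_err f (cube_clamp (x i))))"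

lemma noise_summand_bound:
  assumes "f \<in> F"
  shows "\<bar>\<Sum>i<n. e i * (f (cube_clamp (x i)) - fstar (cube_clamp (x i)))\<bar> \<le> 2 * B * (\<Sum>i<n. \<bar>e i\<bar>)"
proof -
  have "\<bar>\<Sum>i<n. e i * (f (cube_clamp (x i)) - fstar (cube_clamp (x i)))\<bar>
      \<le> (\<Sum>i<n. \<bar>e i\<bar> * \<bar>f (cube_clamp (x i)) - fstar (cube_clamp (x i))\<bar>)"
    by (rule order_trans[OF sum_abs]) (simp add: abs_mult)
  also have "\<dots> \<le> (\<Sum>i<n. \<bar>e i\<bar> * (2 * B))"
    by (intro sum_mono mult_left_mono F_diff_bound[OF assms cube_clamp_in]) simp
  finally show ?thesis by (simp add: sum_distrib_left mult_ac)
qed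

lemma ghost_summand_bound:
  assumes "f \<in> F" "\<And>i. i < n \<Longrightarrow> \<bar>s i\<bar> \<le> 1"
  shows "\<bar>\<Sum>i<n. s i * (sq_err f (cube_clamp (x (n + i))) - sq_err f (cube_clamp (x i)))\<bar>
    \<le> real n * (2 * B)\<^sup>2"
proof -
  have "\<bar>s i * (sq_err f (cube_clamp (x (n + i))) - sq_err f (cube_clamp (x i)))\<bar> \<le> 1 * (2 * B)\<^sup>2"
    if "i < n" for i
    unfolding abs_mult
  proof (rule mult_mono)
    show "\<bar>sq_err f (cube_clamp (x (n + i))) - sq_err f (cube_clamp (x i))\<bar> \<le> (2 * B)\<^sup>2"
      using sq_err_bound[OF assms(1) cube_clamp_in, of "x (n + i)"]
        sq_err_bound[OF assms(1) cube_clamp_in, of "x i"]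
        zero_le_power2[of "f (cube_clamp (x (n + i))) - fstar (cube_clamp (x (n + i)))"]
        zero_le_power2[of "f (cube_clamp (x i)) - fstar (cube_clamp (x i))"] by linarith
  qed (use assms(2)[OF that] in auto)
  then have "(\<Sum>i<n. \<bar>s i * (sq_err f (cube_clamp (x (n + i))) - sq_err f (cube_clamp (x i)))\<bar>)
      \<le> (\<Sum>i<n. (2 * B)\<^sup>2)"
    by (intro sum_mono) simp
  then show ?thesis
    by (intro order_trans[OF sum_abs]) simp
qed

lemma bdd_above_noise:
  "bdd_above ((\<lambda>f. \<Sum>i<n. e i * (f (cube_clamp (x i)) - fstar (cube_clamp (x i)))) ` F)"
  by (rule bdd_aboveI2) (rule order_trans[OF abs_ge_self noise_summand_bound])

lemma bdd_above_ghost: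
  assumes "\<And>i. i < n \<Longrightarrow> \<bar>s i\<bar> \<le> 1"
  shows "bdd_above ((\<lambda>f. \<Sum>i<n. s i *
    (sq_err f (cube_clamp (x (n + i))) - sq_err f (cube_clamp (x i)))) ` F)"
  by (rule bdd_aboveI2) (rule order_trans[OF abs_ge_self ghost_summand_bound[OF _ assms]])

lemma noise_sup_upper:
  "f \<in> F \<Longrightarrow> (\<Sum>i<n. e i * (f (cube_clamp (x i)) - fstar (cube_clamp (x i)))) \<le> noise_sup (e, x)"
  unfolding noise_sup_def prod.case by (rule cSUP_upper[OF _ bdd_above_noise])

lemma ghost_sup_upper:
  assumes "f \<in> F"
  shows "(\<Sum>i<n. sq_err f (cube_clamp (x (n + i))) - sq_err f (cube_clamp (x i))) \<le> ghost_sup (\<lambda>_. 1) x"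
  unfolding ghost_sup_def using cSUP_upper[OF assms bdd_above_ghost[of "\<lambda>_. 1" x]] by simp

lemma noise_sup_nonneg: "0 \<le> noise_sup (e, x)"
  using noise_sup_upper[OF fstar, of e x] by simp

lemma noise_sup_le: "noise_sup (e, x) \<le> 2 * B * (\<Sum>i<n. \<bar>e i\<bar>)"
  unfolding noise_sup_def prod.case
  by (intro cSUP_least F_nonempty order_trans[OF abs_ge_self noise_summand_bound])

lemma ghost_sup_nonneg: "0 \<le> ghost_sup (\<lambda>_. 1) x"
  using ghost_sup_upper[OF fstar, of x] by simp

lemma ghost_sup_le: "ghost_sup (\<lambda>_. 1) x \<le> real n * (2 * B)\<^sup>2"
  unfolding ghost_sup_def
  by (intro cSUP_least F_nonempty order_trans[OF abs_ge_self ghost_summand_bound]) simp_all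

lemma borel_measurable_noise_sup: "noise_sup \<in> borel_measurable borel"
proof -
  have "(\<lambda>p. SUP f\<in>F. \<Sum>i<n. fst p i * (f (cube_clamp (snd p i)) - fstar (cube_clamp (snd p i))))
      \<in> borel_measurable borel"
  proof (intro borel_measurable_SUP_continuous F_nonempty bdd_above_noise)
    fix f assume f: "f \<in> F"
    have *: "continuous_on UNIV (\<lambda>p::(nat \<Rightarrow> real) \<times> (nat \<Rightarrow> real ^ 'd). g (cube_clamp (snd p i)))"
      if "g \<in> F" for g i
      by (rule continuous_on_compose2[OF continuous_F_clamp[OF that, of UNIV]
            continuous_on_compose2[OF continuous_on_product_coordinates continuous_on_snd[OF continuous_on_id]]])
        simp_all
    have fst: "continuous_on UNIV (\<lambda>p::(nat \<Rightarrow> real) \<times> (nat \<Rightarrow> real ^ 'd). fst p i)" for i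
      by (rule continuous_on_compose2[OF continuous_on_product_coordinates continuous_on_fst[OF continuous_on_id]])
        simp
    show "continuous_on UNIV (\<lambda>p::(nat \<Rightarrow> real) \<times> (nat \<Rightarrow> real ^ 'd).
        \<Sum>i<n. fst p i * (f (cube_clamp (snd p i)) - fstar (cube_clamp (snd p i))))"
      by (intro continuous_on_sum continuous_on_mult continuous_on_diff * fst f fstar)
  qed
  then show ?thesis
    by (simp add: noise_sup_def case_prod_unfold)
qed

lemma borel_measurable_ghost_sup: "ghost_sup (\<lambda>_. 1) \<in> borel_measurable borel"
proof -
  have "(\<lambda>x. SUP f\<in>F. \<Sum>i<n. 1 * (sq_err f (cube_clamp (x (n + i))) - sq_err f (cube_clamp (x i))))
      \<in> borel_measurable borel"
  proof (intro borel_measurable_SUP_continuous F_nonempty bdd_above_ghost)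
    fix f assume f: "f \<in> F"
    have *: "continuous_on UNIV (\<lambda>x::nat \<Rightarrow> real ^ 'd. g (cube_clamp (x i)))" if "g \<in> F" for g i
      by (rule continuous_on_compose2[OF continuous_F_clamp[OF that, of UNIV] continuous_on_product_coordinates])
        auto
    show "continuous_on UNIV (\<lambda>x::nat \<Rightarrow> real ^ 'd.
        \<Sum>i<n. 1 * (sq_err f (cube_clamp (x (n + i))) - sq_err f (cube_clamp (x i))))"
      by (intro continuous_on_sum continuous_on_mult continuous_on_diff continuous_on_power continuous_on_const
          * f fstar)
  qed simp
  then show ?thesis
    by (simp add: ghost_sup_def[abs_def])
qed

text \<open>Subtracting the value of \<open>fstar\<close> is a translation, hence 1-Lipschitz; the
  noise enters as the coefficients \<open>c\<close>, whose squares appear in the bound.\<close>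

lemma sum_signs_noise_sup_le:
  assumes \<theta>: "0 < \<theta>"
  shows "(\<Sum>s\<in>signs n. noise_sup (\<lambda>i. s i * e i, x))
    \<le> 2 ^ n * (complexity / \<theta> + \<theta> * V\<^sup>2 * (\<Sum>i<n. (e i)\<^sup>2) / 2)"
  unfolding noise_sup_def prod.case
proof (intro sum_cSUP_le F_nonempty bdd_above_noise)
  fix g assume g: "\<And>s. s \<in> signs n \<Longrightarrow> g s \<in> F"
  show "(\<Sum>s\<in>signs n. \<Sum>i<n. s i * e i * (g s (cube_clamp (x i)) - fstar (cube_clamp (x i))))
    \<le> 2 ^ n * (complexity / \<theta> + \<theta> * V\<^sup>2 * (\<Sum>i<n. (e i)\<^sup>2) / 2)"
    using sum_signs_F_le[of \<theta> "\<lambda>i. cube_clamp (x i)" "\<lambda>i y. y - fstar (cube_clamp (x i))" g e] \<theta> g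
    by (simp add: cube_clamp_in mult.assoc)
qed simp

text \<open>Ghost and sample points are treated separately, at the cost of a factor 2. On values
  bounded by \<open>B\<close> the squared error is Lipschitz with constant \<open>4 * B\<close>,
  which together gives \<open>8 * B\<close>.\<close>

lemma sum_signs_ghost_sup_le:
  assumes \<theta>: "0 < \<theta>"
  shows "(\<Sum>s\<in>signs n. ghost_sup s x)
    \<le> 2 ^ n * (8 * B * (complexity / \<theta> + \<theta> * V\<^sup>2 * real n / 2))"
  unfolding ghost_sup_def
proof (intro sum_cSUP_le F_nonempty bdd_above_ghost)
  fix g assume g: "\<And>s. s \<in> signs n \<Longrightarrow> g s \<in> F"
  have half: "(\<Sum>s\<in>signs n. \<Sum>i<n. s i * (c * sq_err (g s) (cube_clamp (y i))))
      \<le> 4 * B * (2 ^ n * (complexity / \<theta> + \<theta> * V\<^sup>2 * real n / 2))"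
    if "c\<^sup>2 = 1" for c and y :: "nat \<Rightarrow> real ^ 'd"
  proof -
    \<comment> \<open>Division by \<open>4 * B\<close> makes the squared error 1-Lipschitz; the
      coefficient \<open>c\<close> is 1 for the ghost half and -1 for the sample half.\<close>
    let ?\<psi> = "\<lambda>i u. (u - fstar (cube_clamp (y i)))\<^sup>2 / (4 * B)"
    have "\<bar>?\<psi> i u - ?\<psi> i v\<bar> \<le> \<bar>u - v\<bar>" if "\<bar>u\<bar> \<le> B" "\<bar>v\<bar> \<le> B" for i u v
    proof -
      let ?w = "fstar (cube_clamp (y i))"
      have "\<bar>(u - ?w)\<^sup>2 - (v - ?w)\<^sup>2\<bar> = \<bar>u + v - 2 * ?w\<bar> * \<bar>u - v\<bar>"
        by (simp add: power2_eq_square algebra_simps flip: abs_mult)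
      also have "\<dots> \<le> (4 * B) * \<bar>u - v\<bar>"
        using that F_bound[OF fstar cube_clamp_in, of "y i"] by (intro mult_right_mono) linarith+
      finally show ?thesis
        using B_pos by (simp add: field_simps flip: diff_divide_distrib)
    qed
    then have "(\<Sum>s\<in>signs n. \<Sum>i<n. s i * (c * ?\<psi> i (g s (cube_clamp (y i)))))
        \<le> 2 ^ n * (complexity / \<theta> + \<theta> * V\<^sup>2 * (\<Sum>i<n. c\<^sup>2) / 2)"
      by (intro sum_signs_F_le \<theta> g cube_clamp_in)
    moreover have "(\<Sum>s\<in>signs n. \<Sum>i<n. s i * (c * sq_err (g s) (cube_clamp (y i)))) =
        4 * B * (\<Sum>s\<in>signs n. \<Sum>i<n. s i * (c * ?\<psi> i (g s (cube_clamp (y i)))))"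
      using B_pos by (simp add: sum_distrib_left)
    ultimately show ?thesis
      using that B_pos by simp
  qed
  have "(\<Sum>s\<in>signs n. \<Sum>i<n. s i * (sq_err (g s) (cube_clamp (x (n + i))) - sq_err (g s) (cube_clamp (x i)))) =
      (\<Sum>s\<in>signs n. \<Sum>i<n. s i * (1 * sq_err (g s) (cube_clamp (x (n + i))))) +
      (\<Sum>s\<in>signs n. \<Sum>i<n. s i * (- 1 * sq_err (g s) (cube_clamp (x i))))"
    by (simp add: right_diff_distrib sum_subtractf sum_negf)
  also have "\<dots> \<le> 4 * B * (2 ^ n * (complexity / \<theta> + \<theta> * V\<^sup>2 * real n / 2)) +
      4 * B * (2 ^ n * (complexity / \<theta> + \<theta> * V\<^sup>2 * real n / 2))"
    by (intro add_mono half) simp_all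
  also have "4 * B * (2 ^ n * c) + 4 * B * (2 ^ n * c) = 2 ^ n * (8 * B * c)" for c
    by simp
  finally show "(\<Sum>s\<in>signs n. \<Sum>i<n. s i *
      (sq_err (g s) (cube_clamp (x (n + i))) - sq_err (g s) (cube_clamp (x i))))
    \<le> 2 ^ n * (8 * B * (complexity / \<theta> + \<theta> * V\<^sup>2 * real n / 2))" .
next
  fix s i assume "s \<in> signs n" "i < n"
  then show "\<bar>s i\<bar> \<le> 1" using signsD[of s n i] by auto
qed simp

end

section \<open>Symmetrisation\<close>

text \<open>It suffices to compare on rectangles, whose preimages are again rectangles. The maps of
  interest are sign changes of the noise coordinates.\<close>

lemma distr_PiM_measure_preserving:
  assumes N: "prob_space N" and I: "finite I"
    and T [measurable]: "\<And>i. i \<in> I \<Longrightarrow> T i \<in> measurable N N"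
    and T_distr: "\<And>i. i \<in> I \<Longrightarrow> distr N N (T i) = N"
  shows "distr (Pi\<^sub>M I (\<lambda>_. N)) (Pi\<^sub>M I (\<lambda>_. N)) (\<lambda>x. \<lambda>i\<in>I. T i (x i)) = Pi\<^sub>M I (\<lambda>_. N)"
proof -
  interpret N: prob_space N by fact
  interpret product_sigma_finite "\<lambda>_. N" ..
  show ?thesis
  proof (rule PiM_eqI)
    fix A assume A: "\<And>i. i \<in> I \<Longrightarrow> A i \<in> sets N"
    let ?A = "\<lambda>i. T i -` A i \<inter> space N"
    have "(\<lambda>x. \<lambda>i\<in>I. T i (x i)) -` Pi\<^sub>E I A \<inter> space (Pi\<^sub>M I (\<lambda>_. N)) = Pi\<^sub>E I ?A"
      by (auto simp: space_PiM PiE_iff)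
    then have "emeasure (distr (Pi\<^sub>M I (\<lambda>_. N)) (Pi\<^sub>M I (\<lambda>_. N)) (\<lambda>x. \<lambda>i\<in>I. T i (x i))) (Pi\<^sub>E I A) =
        emeasure (Pi\<^sub>M I (\<lambda>_. N)) (Pi\<^sub>E I ?A)"
      using A I by (subst emeasure_distr) (auto intro!: sets_PiM_I_finite)
    also have "\<dots> = (\<Prod>i\<in>I. emeasure N (?A i))"
      using A T I by (intro emeasure_PiM) (auto intro: measurable_sets)
    also have "\<dots> = (\<Prod>i\<in>I. emeasure (distr N N (T i)) (A i))"
      using A T by (intro prod.cong refl) (simp add: emeasure_distr)
    also have "\<dots> = (\<Prod>i\<in>I. emeasure N (A i))"
      using T_distr by simp
    finally show "emeasure (distr (Pi\<^sub>M I (\<lambda>_. N)) (Pi\<^sub>M I (\<lambda>_. N)) (\<lambda>x. \<lambda>i\<in>I. T i (x i))) (Pi\<^sub>E I A) =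
        (\<Prod>i\<in>I. emeasure N (A i))" .
  qed (simp_all add: I)
qed

text \<open>As each \<open>\<tau> s\<close> preserves \<open>Q\<close>, composing \<open>W\<close>
  with it leaves the integral unchanged, so a pointwise bound on the average over \<open>S\<close>
  may replace one on \<open>W\<close>. This serves both for sign changes of the noise and for
  exchanges of sample and ghost points.\<close>

lemma symmetrization:
  fixes W R :: "'a \<Rightarrow> real"
  assumes W: "integrable Q W" and R: "integrable Q R"
    and S: "finite S" "S \<noteq> {}"
    and \<tau>: "\<And>s. s \<in> S \<Longrightarrow> \<tau> s \<in> measurable Q Q" "\<And>s. s \<in> S \<Longrightarrow> distr Q Q (\<tau> s) = Q"
    and le: "\<And>\<omega>. \<omega> \<in> space Q \<Longrightarrow> (\<Sum>s\<in>S. W (\<tau> s \<omega>)) \<le> real (card S) * R \<omega>"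
  shows "(\<integral>\<omega>. W \<omega> \<partial>Q) \<le> (\<integral>\<omega>. R \<omega> \<partial>Q)"
proof -
  have Wm: "W \<in> borel_measurable Q" using W by simp
  have int: "integrable Q (\<lambda>\<omega>. W (\<tau> s \<omega>))" if "s \<in> S" for s
    using W integrable_distr_eq[OF \<tau>(1)[OF that] Wm] \<tau>(2)[OF that] by simp
  have eq: "(\<integral>\<omega>. W (\<tau> s \<omega>) \<partial>Q) = (\<integral>\<omega>. W \<omega> \<partial>Q)" if "s \<in> S" for s
    using integral_distr[OF \<tau>(1)[OF that] Wm] \<tau>(2)[OF that] by simp
  have "real (card S) * (\<integral>\<omega>. W \<omega> \<partial>Q) = (\<integral>\<omega>. (\<Sum>s\<in>S. W (\<tau> s \<omega>)) \<partial>Q)"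
    using int eq by simp
  also have "\<dots> \<le> (\<integral>\<omega>. real (card S) * R \<omega> \<partial>Q)"
    using int R le by (intro integral_mono) auto
  also have "\<dots> = real (card S) * (\<integral>\<omega>. R \<omega> \<partial>Q)"
    by simp
  finally show ?thesis
    using S by (simp add: card_gt_0_iff)
qed

lemma distr_normal_sign:
  assumes "0 < \<sigma>" "s = -1 \<or> s = (1::real)"
  defines "N \<equiv> density lborel (normal_density 0 \<sigma>)"
  shows "distr N N (\<lambda>x. s * x) = N"
proof -
  interpret prob_space N
    unfolding N_def using assms(1) by (rule prob_space_normal_density)
  \<comment> \<open>The identity on \<open>N\<close> is itself a normal variable, so the rule for
    affine images applies with factor \<open>s\<close> and shift 0.\<close>
  have "distr N lborel (\<lambda>x. x) = N"
    by (rule distr_id2) (simp add: N_def)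
  then have "distributed N lborel (\<lambda>x. x) (normal_density 0 \<sigma>)"
    unfolding distributed_def by (auto simp: N_def)
  from normal_density_affine[OF this assms(1), of s 0]
  have "distributed N lborel (\<lambda>x. s * x) (normal_density 0 \<sigma>)"
    using assms(2) by auto
  then have "distr N lborel (\<lambda>x. s * x) = N"
    by (simp add: distributed_distr_eq_density N_def)
  moreover have "distr N N (\<lambda>x. s * x) = distr N lborel (\<lambda>x. s * x)"
    by (rule distr_cong) (simp_all add: N_def)
  ultimately show ?thesis by simp
qed

lemma normal_second_moment:
  assumes "0 < \<sigma>"
  shows "has_bochner_integral (density lborel (normal_density 0 \<sigma>)) (\<lambda>x. x\<^sup>2) (\<sigma>\<^sup>2)"
  using normal_moment_even[OF assms, of 0 1] assms
  by (subst has_bochner_integral_density) (auto simp: normal_density_nonneg fact_numeral power2_eq_square)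

text \<open>Points of \<open>Pi\<^sub>M I M\<close> are \<open>undefined\<close> off
  \<open>I\<close>. Filling with 0 lands in the full function space with the Borel sets of the
  product topology, where the suprema have been shown measurable.\<close>

lemma measurable_extend_PiM:
  fixes M :: "'i::countable \<Rightarrow> 'b::{second_countable_topology, zero} measure"
  assumes "\<And>i. i \<in> I \<Longrightarrow> (\<lambda>x. x) \<in> borel_measurable (M i)"
  shows "(\<lambda>x i. if i \<in> I then x i else 0) \<in> borel_measurable (Pi\<^sub>M I M)"
proof (rule measurable_coordinatewise_then_product)
  fix i
  show "(\<lambda>x. if i \<in> I then x i else 0) \<in> borel_measurable (Pi\<^sub>M I M)"
  proof (cases "i \<in> I")
    case True
    then show ?thesis
      using measurable_compose[OF measurable_component_singleton[OF True, of M] assms[OF True]] by simp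
  qed simp
qed

lemma integral_PiM_component:
  fixes g :: "_ \<Rightarrow> real"
  assumes "\<And>i. i \<in> I \<Longrightarrow> prob_space (M i)" "i \<in> I" "g \<in> borel_measurable (M i)"
  shows "(\<integral>x. g (x i) \<partial>Pi\<^sub>M I M) = (\<integral>x. g x \<partial>M i)"
proof -
  have "(\<integral>x. g x \<partial>M i) = (\<integral>x. g x \<partial>distr (Pi\<^sub>M I M) (M i) (\<lambda>x. x i))"
    using distr_PiM_component[of I M i] assms by simp
  also have "\<dots> = (\<integral>x. g (x i) \<partial>Pi\<^sub>M I M)"
    using assms by (intro integral_distr) simp_all
  finally show ?thesis ..
qed

text \<open>Independence is the product formula on rectangles, and these determine the product
  measure.\<close>

lemma distr_pair_indep_rv:
  assumes M: "prob_space M" and indep: "indep_rv M S U T W"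
  shows "distr M (S \<Otimes>\<^sub>M T) (\<lambda>\<omega>. (U \<omega>, W \<omega>)) = distr M S U \<Otimes>\<^sub>M distr M T W"
proof -
  interpret prob_space M by fact
  have U [measurable]: "U \<in> measurable M S" and W [measurable]: "W \<in> measurable M T"
    and ind: "indep_set {U -` A \<inter> space M | A. A \<in> sets S} {W -` A \<inter> space M | A. A \<in> sets T}"
    using indep by (auto simp: indep_rv_def)
  interpret U: prob_space "distr M S U" by (rule prob_space_distr) fact
  interpret W: prob_space "distr M T W" by (rule prob_space_distr) fact
  show ?thesis
  proof (rule pair_measure_eqI[symmetric])
    fix A B assume AB: "A \<in> sets (distr M S U)" "B \<in> sets (distr M T W)"
    then have [measurable]: "A \<in> sets S" "B \<in> sets T" by simp_all
    have "(\<lambda>\<omega>. (U \<omega>, W \<omega>)) -` (A \<times> B) \<inter> space M = (U -` A \<inter> space M) \<inter> (W -` B \<inter> space M)"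
      by auto
    moreover have "prob ((U -` A \<inter> space M) \<inter> (W -` B \<inter> space M)) =
        prob (U -` A \<inter> space M) * prob (W -` B \<inter> space M)"
      using \<open>A \<in> sets S\<close> \<open>B \<in> sets T\<close> by (intro indep_setD[OF ind]) blast+
    ultimately show "emeasure (distr M S U) A * emeasure (distr M T W) B =
        emeasure (distr M (S \<Otimes>\<^sub>M T) (\<lambda>\<omega>. (U \<omega>, W \<omega>))) (A \<times> B)"
      by (simp add: emeasure_distr emeasure_eq_measure ennreal_mult'')
  qed (simp_all add: U.sigma_finite_measure_axioms W.sigma_finite_measure_axioms cong: sets_pair_measure_cong)
qed

section \<open>Expectations of the ghost and the noise supremum\<close>

context relu_regression
begin

lemma noise_sup_cong:
  "(\<And>i. i < n \<Longrightarrow> e i = e' i) \<Longrightarrow> (\<And>i. i < n \<Longrightarrow> x i = x' i) \<Longrightarrow> noise_sup (e, x) = noise_sup (e', x')"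
  by (simp add: noise_sup_def)

lemma ghost_sup_cong:
  "(\<And>i. i < 2 * n \<Longrightarrow> x i = x' i) \<Longrightarrow> ghost_sup s x = ghost_sup s x'"
  by (simp add: ghost_sup_def)

text \<open>The involution of the indices below \<open>2 * n\<close> that exchanges \<open>i\<close>
  and \<open>n + i\<close> where the sign is -1. This reverses the \<open>i\<close>-th difference in
  \<open>ghost_sup\<close>, so signs act as permutations of an i.i.d. sample.\<close>

definition swap_index :: "(nat \<Rightarrow> real) \<Rightarrow> nat \<Rightarrow> nat" where
  "swap_index s i = (if i < n then if s i = -1 then n + i else i
     else if s (i - n) = -1 then i - n else i)"

lemma ghost_sup_swap:
  assumes "s \<in> signs n"
  shows "ghost_sup (\<lambda>_. 1) (\<lambda>i\<in>{..<2 * n}. x (swap_index s i)) = ghost_sup s x"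
proof -
  have "1 * (sq_err f (cube_clamp ((\<lambda>i\<in>{..<2 * n}. x (swap_index s i)) (n + i))) -
      sq_err f (cube_clamp ((\<lambda>i\<in>{..<2 * n}. x (swap_index s i)) i))) =
    s i * (sq_err f (cube_clamp (x (n + i))) - sq_err f (cube_clamp (x i)))" if "i < n" for f i
    using signsD[OF assms that] that by (auto simp: swap_index_def)
  then show ?thesis
    unfolding ghost_sup_def by (intro SUP_cong refl sum.cong) simp
qed

context
  fixes P :: "(real ^ 'd) measure"
  assumes prob_P: "prob_space P" and sets_P: "sets P = sets cube_borel"
begin

lemma space_P_eq: "space P = unit_cube"
  using sets_eq_imp_space_eq[OF sets_P] by (simp add: space_restrict_space)

lemma borel_measurable_ident_P: "(\<lambda>x. x) \<in> borel_measurable P"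
  unfolding measurable_cong_sets[OF sets_P refl] by (rule measurable_restrict_space1) simp

lemma product_prob_space_P: "product_prob_space (\<lambda>_. P)"
  using prob_P by (intro product_prob_spaceI)

lemma borel_measurable_F:
  assumes "f \<in> F"
  shows "f \<in> borel_measurable P"
  unfolding measurable_cong_sets[OF sets_P refl]
  using continuous_on_F[OF assms] by (rule borel_measurable_continuous_on_restrict)

lemma borel_measurable_sq_err:
  assumes "f \<in> F"
  shows "sq_err f \<in> borel_measurable P"
  using borel_measurable_F[OF assms] borel_measurable_F[OF fstar] by measurable

lemma integrable_ghost_sup: "integrable (Pi\<^sub>M {..<2 * n} (\<lambda>_. P)) (ghost_sup (\<lambda>_. 1))"
proof -
  interpret product_prob_space "\<lambda>_. P" by (rule product_prob_space_P)
  interpret prob_space "Pi\<^sub>M {..<2 * n} (\<lambda>_. P)" by (intro prob_space_PiM prob_P)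
  have "(\<lambda>x. ghost_sup (\<lambda>_. 1) (\<lambda>i. if i \<in> {..<2 * n} then x i else 0)) \<in> borel_measurable (Pi\<^sub>M {..<2 * n} (\<lambda>_. P))"
    using measurable_extend_PiM borel_measurable_ghost_sup
    by (rule measurable_compose) (rule borel_measurable_ident_P)
  also have "(\<lambda>x. ghost_sup (\<lambda>_. 1) (\<lambda>i. if i \<in> {..<2 * n} then x i else 0)) = ghost_sup (\<lambda>_. 1)"
    by (intro ext ghost_sup_cong) simp
  finally show ?thesis
    using ghost_sup_nonneg ghost_sup_le
    by (intro integrable_const_bound[where B = "real n * (2 * B)\<^sup>2"] AE_I2) simp_all
qed

text \<open>Permuting coordinates preserves the product measure, so \<open>symmetrization\<close>
  applies; the sign average has the same constant bound at every point.\<close>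

lemma ghost_sup_expectation_le:
  assumes \<theta>: "0 < \<theta>"
  shows "(\<integral>x. ghost_sup (\<lambda>_. 1) x \<partial>Pi\<^sub>M {..<2 * n} (\<lambda>_. P))
    \<le> 8 * B * (complexity / \<theta> + \<theta> * V\<^sup>2 * real n / 2)"
proof -
  interpret product_prob_space "\<lambda>_. P" by (rule product_prob_space_P)
  interpret Q: prob_space "Pi\<^sub>M {..<2 * n} (\<lambda>_. P)" by (intro prob_space_PiM prob_P)
  let ?Q = "Pi\<^sub>M {..<2 * n} (\<lambda>_. P)"
  let ?C = "8 * B * (complexity / \<theta> + \<theta> * V\<^sup>2 * real n / 2)"
  have swap_in: "swap_index s \<in> {..<2 * n} \<rightarrow> {..<2 * n}" for s
    by (auto simp: swap_index_def)
  have inj: "inj_on (swap_index s) {..<2 * n}" for s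
    by (rule inj_on_inverseI[where g = "swap_index s"]) (auto simp: swap_index_def)
  have "(\<integral>x. ghost_sup (\<lambda>_. 1) x \<partial>?Q) \<le> (\<integral>x. ?C \<partial>?Q)"
  proof (rule symmetrization[where S = "signs n" and \<tau> = "\<lambda>s x. \<lambda>i\<in>{..<2 * n}. x (swap_index s i)"])
    fix s
    show "(\<lambda>x. \<lambda>i\<in>{..<2 * n}. x (swap_index s i)) \<in> measurable ?Q ?Q"
      using swap_in by (intro measurable_restrict measurable_component_singleton) auto
    show "distr ?Q ?Q (\<lambda>x. \<lambda>i\<in>{..<2 * n}. x (swap_index s i)) = ?Q"
      using prob_P by (rule distr_PiM_reindex[OF _ inj swap_in])
  next
    fix x
    show "(\<Sum>s\<in>signs n. ghost_sup (\<lambda>_. 1) (\<lambda>i\<in>{..<2 * n}. x (swap_index s i))) \<le> real (card (signs n)) * ?C"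
      using sum_signs_ghost_sup_le[OF \<theta>] by (simp add: ghost_sup_swap)
  qed (simp_all add: integrable_ghost_sup)
  then show ?thesis by (simp add: Q.prob_space)
qed

text \<open>The ghost supremum with the ghost points integrated out: a function of the sample alone
  that bounds the excess of population over empirical error for all members of \<open>F\<close> at
  once, hence also for one selected by the data.\<close>

definition ghost_gap :: "(nat \<Rightarrow> real ^ 'd) \<Rightarrow> real" where
  "ghost_gap x = (\<integral>x'. ghost_sup (\<lambda>_. 1) (merge {..<n} {n..<2 * n} (x, x')) \<partial>Pi\<^sub>M {n..<2 * n} (\<lambda>_. P))"

lemma ghost_sup_merge_measurable:
  "(\<lambda>p. ghost_sup (\<lambda>_. 1) (merge {..<n} {n..<2 * n} p))
    \<in> borel_measurable (Pi\<^sub>M {..<n} (\<lambda>_. P) \<Otimes>\<^sub>M Pi\<^sub>M {n..<2 * n} (\<lambda>_. P))"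
proof (rule measurable_compose[OF measurable_merge])
  have "{..<n} \<union> {n..<2 * n} = {..<2 * n}" by auto
  then show "ghost_sup (\<lambda>_. 1) \<in> borel_measurable (Pi\<^sub>M ({..<n} \<union> {n..<2 * n}) (\<lambda>_. P))"
    using integrable_ghost_sup by simp
qed

lemma ghost_gap_measurable: "ghost_gap \<in> borel_measurable (Pi\<^sub>M {..<n} (\<lambda>_. P))"
proof -
  interpret product_prob_space "\<lambda>_. P" by (rule product_prob_space_P)
  interpret Q: prob_space "Pi\<^sub>M {n..<2 * n} (\<lambda>_. P)" by (intro prob_space_PiM prob_P)
  show ?thesis
    unfolding ghost_gap_def[abs_def]
    using ghost_sup_merge_measurable by (intro Q.borel_measurable_lebesgue_integral) (simp add: case_prod_unfold)
qed

lemma ghost_gap_expectation: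
  "(\<integral>x. ghost_gap x \<partial>Pi\<^sub>M {..<n} (\<lambda>_. P)) = (\<integral>x. ghost_sup (\<lambda>_. 1) x \<partial>Pi\<^sub>M {..<2 * n} (\<lambda>_. P))"
proof -
  interpret product_prob_space "\<lambda>_. P" by (rule product_prob_space_P)
  have un: "{..<n} \<union> {n..<2 * n} = {..<2 * n}" by auto
  show ?thesis
    unfolding ghost_gap_def
    by (rule product_integral_fold[of "{..<n}" "{n..<2 * n}" "ghost_sup (\<lambda>_. 1)", symmetric, unfolded un])
      (auto intro: integrable_ghost_sup)
qed

text \<open>The population error is the mean of the error at a ghost point, and the supremum inside
  the integral dominates every single \<open>f\<close>. The first two bounds later give
  integrability.\<close>

lemma ghost_gap_bounds:
  assumes "x \<in> space (Pi\<^sub>M {..<n} (\<lambda>_. P))"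
  shows "0 \<le> ghost_gap x" "ghost_gap x \<le> real n * (2 * B)\<^sup>2"
    and "f \<in> F \<Longrightarrow> real n * sq_L2_norm P (\<lambda>u. f u - fstar u) - (\<Sum>i<n. sq_err f (x i)) \<le> ghost_gap x"
proof -
  interpret product_prob_space "\<lambda>_. P" by (rule product_prob_space_P)
  interpret Q: prob_space "Pi\<^sub>M {n..<2 * n} (\<lambda>_. P)" by (intro prob_space_PiM prob_P)
  let ?Q = "Pi\<^sub>M {n..<2 * n} (\<lambda>_. P)"
  let ?g = "\<lambda>x'. ghost_sup (\<lambda>_. 1) (merge {..<n} {n..<2 * n} (x, x'))"
  have int: "integrable ?Q ?g"
    using ghost_sup_nonneg ghost_sup_le measurable_Pair1'[OF assms]
    by (intro Q.integrable_const_bound[where B = "real n * (2 * B)\<^sup>2"] AE_I2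
        measurable_compose[OF _ ghost_sup_merge_measurable]) simp_all
  show "0 \<le> ghost_gap x"
    unfolding ghost_gap_def by (intro Bochner_Integration.integral_nonneg ghost_sup_nonneg)
  show "ghost_gap x \<le> real n * (2 * B)\<^sup>2"
    unfolding ghost_gap_def by (intro Q.integral_le_const int AE_I2 ghost_sup_le)
  assume f: "f \<in> F"
  have in_cube: "x' (n + i) \<in> unit_cube" if "x' \<in> space ?Q" "i < n" for x' i
    using that PiE_mem[of x' "{n..<2 * n}" "\<lambda>_. space P" "n + i"] by (simp add: space_PiM space_P_eq)
  have comp: "integrable ?Q (\<lambda>x'. sq_err f (x' (n + i)))" if "i < n" for i
    using that sq_err_bound[OF f] in_cube
    by (intro Q.integrable_const_bound[where B = "(2 * B)\<^sup>2"] AE_I2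
        measurable_compose[OF measurable_component_singleton[of "n + i" _ "\<lambda>_. P"] borel_measurable_sq_err[OF f]])
      auto
  have mean: "(\<integral>x'. sq_err f (x' (n + i)) \<partial>?Q) = sq_L2_norm P (\<lambda>u. f u - fstar u)" if "i < n" for i
    unfolding sq_L2_norm_def using that by (intro integral_PiM_component[where M = "\<lambda>_. P"] borel_measurable_sq_err f prob_P) auto
  have "real n * sq_L2_norm P (\<lambda>u. f u - fstar u) - (\<Sum>i<n. sq_err f (x i)) =
      (\<integral>x'. (\<Sum>i<n. sq_err f (x' (n + i)) - sq_err f (x i)) \<partial>?Q)"
  proof -
    have "(\<integral>x'. (\<Sum>i<n. sq_err f (x' (n + i)) - sq_err f (x i)) \<partial>?Q) =
        (\<Sum>i<n. \<integral>x'. sq_err f (x' (n + i)) - sq_err f (x i) \<partial>?Q)"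
      using comp by (intro Bochner_Integration.integral_sum) simp
    also have "\<dots> = (\<Sum>i<n. sq_L2_norm P (\<lambda>u. f u - fstar u) - sq_err f (x i))"
      using comp mean by (intro sum.cong) (simp_all add: Q.prob_space)
    finally show ?thesis by (simp add: sum_subtractf)
  qed
  also have "\<dots> \<le> ghost_gap x"
    unfolding ghost_gap_def
  proof (rule integral_mono)
    fix x' assume x': "x' \<in> space ?Q"
    \<comment> \<open>Sample and ghost points lie in the cube, so clamping fixes them.\<close>
    have "cube_clamp (merge {..<n} {n..<2 * n} (x, x') (n + i)) = x' (n + i)"
      "cube_clamp (merge {..<n} {n..<2 * n} (x, x') i) = x i" if "i < n" for i
      using that in_cube[OF x'] assms by (auto simp: merge_def space_PiM space_P_eq PiE_iff intro!: cube_clamp_id)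
    then show "(\<Sum>i<n. sq_err f (x' (n + i)) - sq_err f (x i)) \<le> ?g x'"
      using ghost_sup_upper[OF f, of "merge {..<n} {n..<2 * n} (x, x')"] by simp
  qed (use comp int in auto)
  finally show "real n * sq_L2_norm P (\<lambda>u. f u - fstar u) - (\<Sum>i<n. sq_err f (x i)) \<le> ghost_gap x" .
qed

end

text \<open>The points are held fixed and only the noise is averaged. Its law is invariant under
  sign changes, and the bound on the sign average is affine in
  \<open>\<Sum>i<n. (e i)\<^sup>2\<close>, whose mean is
  \<open>n * \<sigma>\<^sup>2\<close>.\<close>

lemma noise_sup_expectation_le:
  assumes \<theta>: "0 < \<theta>" and \<sigma>: "0 < \<sigma>"
  defines "N \<equiv> density lborel (normal_density 0 \<sigma>)"
  shows "(\<integral>e. noise_sup (e, x) \<partial>Pi\<^sub>M {..<n} (\<lambda>_. N))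
    \<le> complexity / \<theta> + \<theta> * V\<^sup>2 * real n * \<sigma>\<^sup>2 / 2"
proof -
  have N: "prob_space N"
    unfolding N_def using \<sigma> by (rule prob_space_normal_density)
  interpret product_prob_space "\<lambda>_. N"
    using N by (intro product_prob_spaceI)
  interpret N: prob_space N by fact
  interpret Q: prob_space "Pi\<^sub>M {..<n} (\<lambda>_. N)" by (intro prob_space_PiM N)
  let ?Q = "Pi\<^sub>M {..<n} (\<lambda>_. N)"
  have ident: "(\<lambda>x. x) \<in> borel_measurable N" by (simp add: N_def)
  have coord: "(\<lambda>e. e i) \<in> borel_measurable ?Q" if "i < n" for i
    using that by (intro measurable_compose[OF measurable_component_singleton[of i _ "\<lambda>_. N"] ident]) simp
  have sq: "integrable ?Q (\<lambda>e. (e i)\<^sup>2)" "(\<integral>e. (e i)\<^sup>2 \<partial>?Q) = \<sigma>\<^sup>2" if "i < n" for i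
  proof -
    have i: "i \<in> {..<n}" using that by simp
    have m: "(\<lambda>x. x\<^sup>2) \<in> borel_measurable N" by (simp add: N_def)
    show "integrable ?Q (\<lambda>e. (e i)\<^sup>2)"
      using integrable_distr_eq[OF measurable_component_singleton[OF i, of "\<lambda>_. N"] m]
        normal_second_moment[OF \<sigma>] distr_PiM_component[OF N i]
      by (auto simp: has_bochner_integral_iff N_def[symmetric])
    show "(\<integral>e. (e i)\<^sup>2 \<partial>?Q) = \<sigma>\<^sup>2"
      using integral_PiM_component[OF N i m] normal_second_moment[OF \<sigma>]
      by (simp add: has_bochner_integral_iff N_def[symmetric])
  qed
  have sum_int: "integrable ?Q (\<lambda>e. \<Sum>i<n. (e i)\<^sup>2)"
    by (intro Bochner_Integration.integrable_sum sq) simp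
  have abs: "integrable ?Q (\<lambda>e. \<bar>e i\<bar>)" if "i < n" for i
    using Q.square_integrable_imp_integrable[OF coord[OF that] sq(1)[OF that]] by simp
  have "(\<lambda>e. noise_sup (\<lambda>i. if i \<in> {..<n} then e i else 0, x)) \<in> borel_measurable ?Q"
  proof (rule measurable_compose[OF _ borel_measurable_noise_sup])
    show "(\<lambda>e. (\<lambda>i. if i \<in> {..<n} then e i else 0, x)) \<in> borel_measurable ?Q"
      using measurable_extend_PiM[of "{..<n}" "\<lambda>_. N"] ident by (simp add: borel_measurable_Pair)
  qed
  also have "(\<lambda>e. noise_sup (\<lambda>i. if i \<in> {..<n} then e i else 0, x)) = (\<lambda>e. noise_sup (e, x))"
    by (intro ext noise_sup_cong) simp_all
  finally have "integrable ?Q (\<lambda>e. noise_sup (e, x))"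
  proof (rule Bochner_Integration.integrable_bound[rotated])
    show "integrable ?Q (\<lambda>e. 2 * B * (\<Sum>i<n. \<bar>e i\<bar>))"
      by (intro integrable_mult_right Bochner_Integration.integrable_sum abs) simp
    show "AE e in ?Q. norm (noise_sup (e, x)) \<le> norm (2 * B * (\<Sum>i<n. \<bar>e i\<bar>))"
      using noise_sup_le noise_sup_nonneg by (intro AE_I2) (metis abs_ge_self abs_of_nonneg order_trans real_norm_def)
  qed
  then have "(\<integral>e. noise_sup (e, x) \<partial>?Q) \<le>
      (\<integral>e. complexity / \<theta> + \<theta> * V\<^sup>2 * (\<Sum>i<n. (e i)\<^sup>2) / 2 \<partial>?Q)"
  proof (rule symmetrization[where S = "signs n" and \<tau> = "\<lambda>s e. \<lambda>i\<in>{..<n}. s i * e i"])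
    fix s assume s: "s \<in> signs n"
    show "(\<lambda>e. \<lambda>i\<in>{..<n}. s i * e i) \<in> measurable ?Q ?Q"
    proof (rule measurable_restrict)
      fix i assume "i \<in> {..<n}"
      then show "(\<lambda>e. s i * e i) \<in> measurable ?Q N"
        using coord[of i] by (simp add: N_def cong: measurable_cong_sets)
    qed
    show "distr ?Q ?Q (\<lambda>e. \<lambda>i\<in>{..<n}. s i * e i) = ?Q"
      using distr_normal_sign[OF \<sigma>] signsD[OF s]
      by (intro distr_PiM_measure_preserving N) (auto simp: N_def)
  next
    fix e
    have "noise_sup (\<lambda>i\<in>{..<n}. s i * e i, x) = noise_sup (\<lambda>i. s i * e i, x)" for s
      by (rule noise_sup_cong) simp_all
    then show "(\<Sum>s\<in>signs n. noise_sup (\<lambda>i\<in>{..<n}. s i * e i, x)) \<le>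
        real (card (signs n)) * (complexity / \<theta> + \<theta> * V\<^sup>2 * (\<Sum>i<n. (e i)\<^sup>2) / 2)"
      using sum_signs_noise_sup_le[OF \<theta>] by simp
    show "integrable ?Q (\<lambda>e. complexity / \<theta> + \<theta> * V\<^sup>2 * (\<Sum>i<n. (e i)\<^sup>2) / 2)"
      using sum_int by simp
  qed simp_all
  also have "\<dots> = complexity / \<theta> + \<theta> * V\<^sup>2 * (\<integral>e. (\<Sum>i<n. (e i)\<^sup>2) \<partial>?Q) / 2"
    using sum_int by (simp add: Q.prob_space)
  also have "(\<integral>e. (\<Sum>i<n. (e i)\<^sup>2) \<partial>?Q) = (\<Sum>i<n. \<integral>e. (e i)\<^sup>2 \<partial>?Q)"
    by (intro Bochner_Integration.integral_sum sq) simp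
  also have "\<dots> = real n * \<sigma>\<^sup>2"
    using sq(2) by simp
  also have "complexity / \<theta> + \<theta> * V\<^sup>2 * (real n * \<sigma>\<^sup>2) / 2 = complexity / \<theta> + \<theta> * V\<^sup>2 * real n * \<sigma>\<^sup>2 / 2"
    by simp
  finally show ?thesis .
qed

lemma borel_measurable_noise_sup_pair:
  assumes "\<And>i. (\<lambda>x. x) \<in> borel_measurable (M1 i)" "\<And>i. (\<lambda>x. x) \<in> borel_measurable (M2 i)"
  shows "(\<lambda>(x, e). noise_sup (e, x)) \<in> borel_measurable (Pi\<^sub>M {..<n} M1 \<Otimes>\<^sub>M Pi\<^sub>M {..<n} M2)"
proof -
  let ?ext = "\<lambda>x i. if i \<in> {..<n} then x i else 0"
  have "(\<lambda>p. noise_sup (?ext (snd p), ?ext (fst p)))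
      \<in> borel_measurable (Pi\<^sub>M {..<n} M1 \<Otimes>\<^sub>M Pi\<^sub>M {..<n} M2)"
    using assms
    by (intro measurable_compose[OF _ borel_measurable_noise_sup] borel_measurable_Pair
        measurable_compose[OF measurable_fst measurable_extend_PiM]
        measurable_compose[OF measurable_snd measurable_extend_PiM])
  also have "(\<lambda>p. noise_sup (?ext (snd p), ?ext (fst p))) = (\<lambda>(x, e). noise_sup (e, x))"
    by (auto simp: fun_eq_iff intro!: noise_sup_cong)
  finally show ?thesis .
qed

text \<open>When the squares in the two empirical risks are expanded, the terms
  \<open>(e i)\<^sup>2\<close> cancel and only cross terms remain; the noise supremum bounds these
  whichever \<open>f\<close> the data select.\<close>

lemma basic_inequality:
  assumes f: "f \<in> F" and n: "0 < n"
    and z: "\<And>i. i < n \<Longrightarrow> fst (z i) = x i" "\<And>i. i < n \<Longrightarrow> snd (z i) = fstar (x i) + e i"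
    and x: "\<And>i. i < n \<Longrightarrow> x i \<in> unit_cube"
    and le: "empirical_risk n z f \<le> empirical_risk n z fstar"
  shows "(\<Sum>i<n. sq_err f (x i)) \<le> 2 * noise_sup (e, x)"
proof -
  have "(\<Sum>i<n. (fstar (x i) + e i - f (x i))\<^sup>2) \<le> (\<Sum>i<n. (e i)\<^sup>2)"
    using le n z by (simp add: empirical_risk_def divide_le_cancel)
  moreover have "(fstar (x i) + e i - f (x i))\<^sup>2 = sq_err f (x i) - 2 * (e i * (f (x i) - fstar (x i))) + (e i)\<^sup>2" for i
    by (simp add: power2_eq_square algebra_simps)
  ultimately have "(\<Sum>i<n. sq_err f (x i)) \<le> 2 * (\<Sum>i<n. e i * (f (x i) - fstar (x i)))"
    by (simp add: sum.distrib sum_subtractf sum_distrib_left)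
  also have "(\<Sum>i<n. e i * (f (x i) - fstar (x i))) \<le> noise_sup (e, x)"
    using noise_sup_upper[OF f, of e x] x by (simp add: cube_clamp_id)
  finally show ?thesis by simp
qed

lemma complexity_pos: "0 < complexity"
proof -
  have "1 < 2 * real CARD('d)"
    using zero_less_card_finite[where 'a = 'd] by linarith
  then have "0 < ln (2 * real CARD('d))" by (rule ln_gt_zero)
  then show ?thesis
    unfolding complexity_def by (intro add_nonneg_pos) simp_all
qed

end

section \<open>The optimal temperature and the risk bound\<close>

lemma optimal_temperature:
  assumes "0 < K" "0 < a"
  shows "\<exists>\<theta>>0. K / \<theta> + \<theta> * a\<^sup>2 / 2 = a * sqrt (2 * K)"
proof (intro exI conjI)
  \<comment> \<open>At this \<open>\<theta>\<close> both summands equal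
    \<open>a * sqrt (2 * K) / 2\<close>, so their sum is minimal by the inequality of arithmetic and
    geometric means.\<close>
  let ?\<theta> = "sqrt (2 * K) / a"
  show "0 < ?\<theta>" using assms by simp
  have "K / ?\<theta> = a * (sqrt (2 * K) * sqrt (2 * K)) / (2 * sqrt (2 * K))"
    using assms by simp
  also have "\<dots> = a * sqrt (2 * K) / 2"
    using assms by (simp del: real_sqrt_mult_self)
  finally show "K / ?\<theta> + ?\<theta> * a\<^sup>2 / 2 = a * sqrt (2 * K)"
    using assms by (simp add: power2_eq_square field_simps)
qed

theorem theorem2:
  fixes M :: "'o measure"
    and P :: "(real ^ 'd::finite) measure"
    and X :: "nat \<Rightarrow> 'o \<Rightarrow> real ^ 'd"
    and \<epsilon> Y :: "nat \<Rightarrow> 'o \<Rightarrow> real"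
    and \<phi> :: "real \<Rightarrow> real"
    and L n :: nat
    and V B \<sigma> :: real
    and fstar :: "real ^ 'd \<Rightarrow> real"
    and fhat :: "(nat \<Rightarrow> (real ^ 'd) \<times> real) \<Rightarrow> real ^ 'd \<Rightarrow> real"
  assumes "1-lipschitz_on UNIV \<phi>"
    and "1 \<le> L" and "1 \<le> n" and "0 < V" and "0 < B" and "0 < \<sigma>"
    and "prob_space M"
    and "prob_space P" and "sets P = sets cube_borel"
    and "prob_space.indep_vars M (\<lambda>_. cube_borel) X {..<n}"
    and "\<And>i. i < n \<Longrightarrow> distr M cube_borel (X i) = P"
    and "prob_space.indep_vars M (\<lambda>_. borel) \<epsilon> {..<n}"
    and "\<And>i. i < n \<Longrightarrow> distributed M lborel (\<epsilon> i) (normal_density 0 \<sigma>)"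
    and "indep_rv M
           (Pi\<^sub>M {..<n} (\<lambda>_. cube_borel)) (\<lambda>\<omega>. \<lambda>i\<in>{..<n}. X i \<omega>)
           (Pi\<^sub>M {..<n} (\<lambda>_. borel)) (\<lambda>\<omega>. \<lambda>i\<in>{..<n}. \<epsilon> i \<omega>)"
    and "fstar \<in> bounded_relu_class \<phi> L V B"
    and "\<And>i \<omega>. i < n \<Longrightarrow> \<omega> \<in> space M \<Longrightarrow> Y i \<omega> = fstar (X i \<omega>) + \<epsilon> i \<omega>"
    and "(\<lambda>(z, x). fhat z x) \<in>
           borel_measurable (Pi\<^sub>M {..<n} (\<lambda>_. cube_borel \<Otimes>\<^sub>M borel) \<Otimes>\<^sub>M cube_borel)"
    and "AE \<omega> in M. is_arg_min (empirical_risk n (training_data n X Y \<omega>))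
           (\<lambda>f. f \<in> bounded_relu_class \<phi> L V B) (fhat (training_data n X Y \<omega>))"
  shows "prob_space.expectation M
           (\<lambda>\<omega>. sq_L2_norm P (\<lambda>x. fhat (training_data n X Y \<omega>) x - fstar x))
         \<le> 2 * V * (\<sigma> + 4 * B) *
             sqrt (2 * (real L * ln 2 + ln (2 * real CARD('d))) / real n)"
proof -
  note lip = assms(1) and L = assms(2) and n = assms(3) and V = assms(4) and B = assms(5)
    and \<sigma> = assms(6) and prob_P = assms(8) and sets_P = assms(9) and X_indep = assms(10)
    and X_distr = assms(11) and \<epsilon>_indep = assms(12) and \<epsilon>_normal = assms(13)
    and X\<epsilon>_indep = assms(14) and fstar = assms(15) and Y = assms(16) and argmin = assms(18)
  interpret M: prob_space M by fact
  interpret relu_regression \<phi> L V B fstar n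
    using lip V B fstar by unfold_locales
  define N where "N = density lborel (normal_density 0 \<sigma>)"
  have prob_N: "prob_space N"
    unfolding N_def using \<sigma> by (rule prob_space_normal_density)
  let ?PX = "Pi\<^sub>M {..<n} (\<lambda>_. P)" and ?PE = "Pi\<^sub>M {..<n} (\<lambda>_. N)"
  let ?X = "\<lambda>\<omega>. \<lambda>i\<in>{..<n}. X i \<omega>" and ?E = "\<lambda>\<omega>. \<lambda>i\<in>{..<n}. \<epsilon> i \<omega>"
  let ?BX = "Pi\<^sub>M {..<n} (\<lambda>_. cube_borel) :: (nat \<Rightarrow> real ^ 'd) measure"
  let ?BE = "Pi\<^sub>M {..<n} (\<lambda>_. borel) :: (nat \<Rightarrow> real) measure"
  interpret PX: prob_space ?PX by (intro prob_space_PiM prob_P)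
  interpret PE: prob_space ?PE by (intro prob_space_PiM prob_N)
  interpret XE: pair_sigma_finite ?PX ?PE ..
  have index: "{..<n} \<noteq> {}" using n by (simp add: lessThan_empty_iff)

  have X_meas: "X i \<in> measurable M cube_borel" if "i < n" for i
    using X_indep that by (auto simp: M.indep_vars_def)
  have \<epsilon>_meas: "\<epsilon> i \<in> borel_measurable M" if "i < n" for i
    using \<epsilon>_indep that by (auto simp: M.indep_vars_def)
  have X_cube: "X i \<omega> \<in> unit_cube" if "i < n" "\<omega> \<in> space M" for i \<omega>
    using measurable_space[OF X_meas[OF that(1)] that(2)] by (simp add: space_restrict_space)
  have \<epsilon>_distr: "distr M borel (\<epsilon> i) = N" if "i < n" for i
  proof -
    have "distr M borel (\<epsilon> i) = distr M lborel (\<epsilon> i)"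
      by (rule distr_cong) simp_all
    then show ?thesis
      using \<epsilon>_normal[OF that] by (simp add: distributed_distr_eq_density N_def)
  qed
  have "distr M ?BX ?X = (\<Pi>\<^sub>M i\<in>{..<n}. distr M cube_borel (X i))"
    using M.indep_vars_iff_distr_eq_PiM'[where M' = "\<lambda>_. cube_borel" and X = X, OF index] X_meas X_indep
    by simp
  also have "\<dots> = ?PX"
    using X_distr by (intro PiM_cong) simp_all
  finally have law_X: "distr M ?BX ?X = ?PX" .
  have "distr M ?BE ?E = (\<Pi>\<^sub>M i\<in>{..<n}. distr M borel (\<epsilon> i))"
    using M.indep_vars_iff_distr_eq_PiM'[where M' = "\<lambda>_. borel" and X = \<epsilon>, OF index] \<epsilon>_meas \<epsilon>_indep
    by simp
  also have "\<dots> = ?PE"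
    using \<epsilon>_distr by (intro PiM_cong) simp_all
  finally have law_E: "distr M ?BE ?E = ?PE" .
  \<comment> \<open>Independence of design and noise makes the joint law a product, as Fubini's
    theorem requires below.\<close>
  have law_XE: "distr M (?BX \<Otimes>\<^sub>M ?BE) (\<lambda>\<omega>. (?X \<omega>, ?E \<omega>)) = ?PX \<Otimes>\<^sub>M ?PE"
    using distr_pair_indep_rv[OF M.prob_space_axioms X\<epsilon>_indep] unfolding law_X law_E .
  have X_rv: "?X \<in> measurable M ?BX" and E_rv: "?E \<in> measurable M ?BE"
    using X\<epsilon>_indep by (auto simp: indep_rv_def)
  have XE_rv: "(\<lambda>\<omega>. (?X \<omega>, ?E \<omega>)) \<in> measurable M (?BX \<Otimes>\<^sub>M ?BE)"
    using X_rv E_rv by (rule measurable_Pair)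

  have noise_meas: "(\<lambda>(x, e). noise_sup (e, x)) \<in> borel_measurable (?BX \<Otimes>\<^sub>M ?BE)"
    by (rule borel_measurable_noise_sup_pair) (simp_all add: measurable_restrict_space1)
  have "integrable M (\<epsilon> i)" if "i < n" for i
  proof -
    have "integrable (distr M borel (\<epsilon> i)) (\<lambda>x. x\<^sup>2)"
      unfolding \<epsilon>_distr[OF that] N_def using normal_second_moment[OF \<sigma>] by (simp add: has_bochner_integral_iff)
    then have "integrable M (\<lambda>\<omega>. (\<epsilon> i \<omega>)\<^sup>2)"
      using \<epsilon>_meas[OF that] by (simp add: integrable_distr_eq)
    then show ?thesis
      by (rule M.square_integrable_imp_integrable[OF \<epsilon>_meas[OF that]])
  qed
  then have noise_int: "integrable M (\<lambda>\<omega>. noise_sup (?E \<omega>, ?X \<omega>))"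
  proof (intro Bochner_Integration.integrable_bound[where g = "\<lambda>\<omega>. noise_sup (?E \<omega>, ?X \<omega>)"])
    show "integrable M (\<lambda>\<omega>. 2 * B * (\<Sum>i<n. \<bar>\<epsilon> i \<omega>\<bar>))"
      if "\<And>i. i < n \<Longrightarrow> integrable M (\<epsilon> i)"
      using that by (intro integrable_mult_right Bochner_Integration.integrable_sum integrable_abs) simp_all
    show "(\<lambda>\<omega>. noise_sup (?E \<omega>, ?X \<omega>)) \<in> borel_measurable M"
      using measurable_compose[OF XE_rv noise_meas] by simp
    have "norm (noise_sup (?E \<omega>, ?X \<omega>)) \<le> norm (2 * B * (\<Sum>i<n. \<bar>\<epsilon> i \<omega>\<bar>))" for \<omega>
      using noise_sup_le[of "?E \<omega>" "?X \<omega>"] noise_sup_nonneg[of "?E \<omega>" "?X \<omega>"] by simp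
    then show "AE \<omega> in M. norm (noise_sup (?E \<omega>, ?X \<omega>)) \<le> norm (2 * B * (\<Sum>i<n. \<bar>\<epsilon> i \<omega>\<bar>))"
      by (intro AE_I2)
  qed
  \<comment> \<open>Fubini: a bound on the noise average that is uniform in the points survives
    integration over the points.\<close>
  have noise_expectation: "(\<integral>\<omega>. noise_sup (?E \<omega>, ?X \<omega>) \<partial>M) \<le> C"
    if "\<And>x. (\<integral>e. noise_sup (e, x) \<partial>?PE) \<le> C" "0 \<le> C" for C
  proof -
    have int: "integrable (?PX \<Otimes>\<^sub>M ?PE) (\<lambda>(x, e). noise_sup (e, x))"
      unfolding law_XE[symmetric] using noise_int by (simp add: integrable_distr_eq[OF XE_rv noise_meas])
    have "(\<integral>\<omega>. noise_sup (?E \<omega>, ?X \<omega>) \<partial>M) = (\<integral>(x, e). noise_sup (e, x) \<partial>(?PX \<Otimes>\<^sub>M ?PE))"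
      unfolding law_XE[symmetric] by (simp add: integral_distr[OF XE_rv noise_meas])
    also have "\<dots> = (\<integral>x. (\<integral>e. noise_sup (e, x) \<partial>?PE) \<partial>?PX)"
      using XE.integral_fst'[OF int] by simp
    also have "\<dots> \<le> (\<integral>x. C \<partial>?PX)"
      using that by (intro integral_mono_AE') simp_all
    finally show ?thesis by (simp add: PX.prob_space)
  qed

  note gap_bounds = ghost_gap_bounds[OF prob_P sets_P]
  have gap_meas: "ghost_gap P \<in> borel_measurable ?BX"
    using ghost_gap_measurable[OF prob_P sets_P] sets_P
    by (simp cong: measurable_cong_sets sets_PiM_cong)
  have X_space: "?X \<omega> \<in> space ?PX" if "\<omega> \<in> space M" for \<omega>
    using measurable_space[OF X_rv that] sets_eq_imp_space_eq[OF sets_P] by (simp add: space_PiM)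
  have gap_int: "integrable M (\<lambda>\<omega>. ghost_gap P (?X \<omega>))"
  proof (rule M.integrable_const_bound)
    show "(\<lambda>\<omega>. ghost_gap P (?X \<omega>)) \<in> borel_measurable M"
      by (rule measurable_compose[OF X_rv gap_meas])
    show "AE \<omega> in M. norm (ghost_gap P (?X \<omega>)) \<le> real n * (2 * B)\<^sup>2"
      using gap_bounds(1,2)[OF X_space] by (intro AE_I2) simp
  qed
  have gap_expectation: "(\<integral>\<omega>. ghost_gap P (?X \<omega>) \<partial>M) =
      (\<integral>x. ghost_sup (\<lambda>_. 1) x \<partial>Pi\<^sub>M {..<2 * n} (\<lambda>_. P))"
    unfolding ghost_gap_expectation[OF prob_P sets_P, symmetric] law_X[symmetric]
    using integral_distr[OF X_rv gap_meas] by simp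

  let ?risk = "\<lambda>\<omega>. sq_L2_norm P (\<lambda>x. fhat (training_data n X Y \<omega>) x - fstar x)"
  \<comment> \<open>Multiplied by \<open>n\<close>, the risk splits into the empirical squared
    error, bounded by twice the noise supremum, and the excess of the population error over it,
    bounded by the ghost gap.\<close>
  have "AE \<omega> in M. ?risk \<omega> \<le> (2 * noise_sup (?E \<omega>, ?X \<omega>) + ghost_gap P (?X \<omega>)) / real n"
    using argmin AE_space
  proof eventually_elim
    fix \<omega> assume arg: "is_arg_min (empirical_risk n (training_data n X Y \<omega>)) (\<lambda>f. f \<in> F)
      (fhat (training_data n X Y \<omega>))" and \<omega>: "\<omega> \<in> space M"
    let ?f = "fhat (training_data n X Y \<omega>)"
    have f: "?f \<in> F" using arg by (simp add: is_arg_min_def)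
    have "(\<Sum>i<n. sq_err ?f (?X \<omega> i)) \<le> 2 * noise_sup (?E \<omega>, ?X \<omega>)"
    proof (rule basic_inequality[OF f])
      show "empirical_risk n (training_data n X Y \<omega>) ?f \<le> empirical_risk n (training_data n X Y \<omega>) fstar"
        using arg fstar by (auto simp: is_arg_min_def not_less)
    qed (use n X_cube \<omega> Y in \<open>auto simp: training_data_def\<close>)
    moreover have "real n * ?risk \<omega> - (\<Sum>i<n. sq_err ?f (?X \<omega> i)) \<le> ghost_gap P (?X \<omega>)"
      by (rule gap_bounds(3)[OF X_space[OF \<omega>] f])
    ultimately show "?risk \<omega> \<le> (2 * noise_sup (?E \<omega>, ?X \<omega>) + ghost_gap P (?X \<omega>)) / real n"
      using n by (simp add: field_simps)
  qed
  then have "(\<integral>\<omega>. ?risk \<omega> \<partial>M) \<le> (\<integral>\<omega>. (2 * noise_sup (?E \<omega>, ?X \<omega>) + ghost_gap P (?X \<omega>)) / real n \<partial>M)"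
  proof (intro integral_mono_AE')
    \<comment> \<open>The monotonicity rule asks for an integrable nonnegative majorant; both terms
      are nonnegative because \<open>fstar\<close> competes in the suprema.\<close>
    show "AE \<omega> in M. 0 \<le> (2 * noise_sup (?E \<omega>, ?X \<omega>) + ghost_gap P (?X \<omega>)) / real n"
      using noise_sup_nonneg gap_bounds(1)[OF X_space] by (intro AE_I2) simp
  qed (use noise_int gap_int in simp_all)
  also have "\<dots> = (2 * (\<integral>\<omega>. noise_sup (?E \<omega>, ?X \<omega>) \<partial>M) + (\<integral>\<omega>. ghost_gap P (?X \<omega>) \<partial>M)) / real n"
    using noise_int gap_int by simp
  finally have risk_le: "(\<integral>\<omega>. ?risk \<omega> \<partial>M) \<le>
    (2 * (\<integral>\<omega>. noise_sup (?E \<omega>, ?X \<omega>) \<partial>M) + (\<integral>\<omega>. ghost_gap P (?X \<omega>) \<partial>M)) / real n" .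

  let ?r = "sqrt (real n) * sqrt (2 * complexity)"
  \<comment> \<open>The noise term has \<open>a = V * \<sigma> * sqrt n\<close> and the ghost term
    \<open>a = V * sqrt n\<close>, so each gets its own temperature.\<close>
  obtain \<theta> where \<theta>: "0 < \<theta>"
    "complexity / \<theta> + \<theta> * (V * \<sigma> * sqrt (real n))\<^sup>2 / 2 = V * \<sigma> * sqrt (real n) * sqrt (2 * complexity)"
    using optimal_temperature[OF complexity_pos, of "V * \<sigma> * sqrt (real n)"] V \<sigma> n by auto
  have noise_le: "(\<integral>\<omega>. noise_sup (?E \<omega>, ?X \<omega>) \<partial>M) \<le> V * \<sigma> * ?r"
  proof (rule noise_expectation)
    show "(\<integral>e. noise_sup (e, x) \<partial>?PE) \<le> V * \<sigma> * ?r" for x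
      using noise_sup_expectation_le[OF \<theta>(1) \<sigma>, of x] \<theta>(2)
      by (simp add: N_def power_mult_distrib mult_ac)
    show "0 \<le> V * \<sigma> * ?r"
      using V \<sigma> complexity_pos by simp
  qed
  obtain \<theta>' where \<theta>': "0 < \<theta>'"
    "complexity / \<theta>' + \<theta>' * (V * sqrt (real n))\<^sup>2 / 2 = V * sqrt (real n) * sqrt (2 * complexity)"
    using optimal_temperature[OF complexity_pos, of "V * sqrt (real n)"] V n by auto
  then have \<theta>'_eq: "complexity / \<theta>' + \<theta>' * V\<^sup>2 * real n / 2 = V * ?r"
    by (simp add: power_mult_distrib mult_ac)
  have gap_le: "(\<integral>\<omega>. ghost_gap P (?X \<omega>) \<partial>M) \<le> 8 * B * (V * ?r)"
    unfolding gap_expectation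
    using ghost_sup_expectation_le[OF prob_P sets_P \<theta>'(1)] unfolding \<theta>'_eq .
  \<comment> \<open>The final constant arises as
    \<open>2 * V * \<sigma> + 8 * B * V = 2 * V * (\<sigma> + 4 * B)\<close>.\<close>
  have "(\<integral>\<omega>. ?risk \<omega> \<partial>M) \<le> (2 * (V * \<sigma> * ?r) + 8 * B * (V * ?r)) / real n"
    using noise_le gap_le
    by (intro order_trans[OF risk_le] divide_right_mono add_mono) simp_all
  also have "\<dots> = 2 * V * (\<sigma> + 4 * B) * (?r / real n)"
    by (simp add: algebra_simps add_divide_distrib)
  also have "?r / real n = ?r / (sqrt (real n) * sqrt (real n))"
    by simp
  also have "\<dots> = sqrt (2 * complexity / real n)"
    using n by (simp add: real_sqrt_divide del: real_sqrt_mult_self)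
  \<comment> \<open>The bound so far has \<open>L - 1\<close> inside \<open>complexity\<close>;
    enlarging it to \<open>L\<close> gives the stated form.\<close>
  also have "2 * V * (\<sigma> + 4 * B) * sqrt (2 * complexity / real n)
      \<le> 2 * V * (\<sigma> + 4 * B) * sqrt (2 * (real L * ln 2 + ln (2 * real CARD('d))) / real n)"
    using V \<sigma> B by (intro mult_left_mono real_sqrt_le_mono divide_right_mono)
      (simp_all add: complexity_def mult_right_mono)
  finally show ?thesis .
qed

end
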